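(* Let $L_B$ be a self-adjoint operator on the Hilbert space $H_B$ with $L_B\ge\ell_B I$ for some $\ell_B>0$. Let $m\ge1$ be an integer and $s>m/2$. Then $$T_{m,s}(L_B):=\int_{\mathbb{R}^m}\frac{d^mq}{(2\pi)^m}\,(L_B+|q|^2)^{-s}$$ exists as an operator-norm Bochner integral and satisfies $$T_{m,s}(L_B)=\frac{1}{(4\pi)^{m/2}\Gamma(s)}\int_0^\infty t^{\,s-1-m/2}\,e^{-tL_B}\,dt.$$ Equivalently, $$T_{m,s}(L_B)=\frac{1}{(4\pi)^{m/2}}\,\frac{\Gamma(s-m/2)}{\Gamma(s)}\,L_B^{m/2-s}.$$
   Context: $H_B=L^2(B,d\mu_B)$ with $B$ a three-dimensional Riemannian manifold or compactified three-dimensional region. Powers and exponentials of $L_B$ are defined by the spectral theorem. *)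

theory Defs
  imports "HOL-Analysis.Analysis"
begin

section \<open>Complex Hilbert spaces\<close>

text \<open>
  The inner product is conjugate-linear in the first argument. The real inner product inherited
  from \<open>real_inner\<close> is its real part, so both induce the same norm.
\<close>

class complex_hilbert = real_inner + complete_space +
  fixes scaleC :: "complex \<Rightarrow> 'a \<Rightarrow> 'a" (infixr \<open>*\<^sub>C\<close> 75)
    and cinner :: "'a \<Rightarrow> 'a \<Rightarrow> complex"
  assumes scaleC_add_right: "a *\<^sub>C (x + y) = a *\<^sub>C x + a *\<^sub>C y"
    and scaleC_add_left: "(a + b) *\<^sub>C x = a *\<^sub>C x + b *\<^sub>C x"
    and scaleC_scaleC: "a *\<^sub>C (b *\<^sub>C x) = (a * b) *\<^sub>C x"
    and scaleC_of_real: "complex_of_real r *\<^sub>C x = r *\<^sub>R x"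
    and cinner_commute: "cinner x y = cnj (cinner y x)"
    and cinner_add_right: "cinner x (y + z) = cinner x y + cinner x z"
    and cinner_scaleC_right: "cinner x (a *\<^sub>C y) = a * cinner x y"
    and Re_cinner: "Re (cinner x y) = inner x y"

instance complex_hilbert \<subseteq> banach ..

instantiation complex :: complex_hilbert
begin

definition scaleC_complex :: "complex \<Rightarrow> complex \<Rightarrow> complex"
  where "scaleC_complex a x = a * x"

definition cinner_complex :: "complex \<Rightarrow> complex \<Rightarrow> complex"
  where "cinner_complex x y = cnj x * y"

instance
  by standard
    (simp_all add: scaleC_complex_def cinner_complex_def algebra_simps scaleR_conv_of_real
      inner_complex_def)

end


section \<open>Unbounded operators\<close>

text \<open>
  An operator is identified with its graph: \<open>(x, y) \<in> L\<close> means that \<open>x\<close> lies in the domain of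
  \<open>L\<close> and \<open>L x = y\<close>.
\<close>

type_synonym 'h graph_op = "('h \<times> 'h) set"

definition linear_graph :: "'h::complex_hilbert graph_op \<Rightarrow> bool"
  where "linear_graph L \<longleftrightarrow>
    single_valued L \<and> (0, 0) \<in> L \<and>
    (\<forall>x y u v. (x, y) \<in> L \<longrightarrow> (u, v) \<in> L \<longrightarrow> (x + u, y + v) \<in> L) \<and>
    (\<forall>a x y. (x, y) \<in> L \<longrightarrow> (a *\<^sub>C x, a *\<^sub>C y) \<in> L)"

definition adjoint_graph :: "'h::complex_hilbert graph_op \<Rightarrow> 'h graph_op"
  where "adjoint_graph L = {(u, v). \<forall>(x, y) \<in> L. cinner u y = cinner v x}"

definition self_adjoint :: "'h::complex_hilbert graph_op \<Rightarrow> bool"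
  where "self_adjoint L \<longleftrightarrow>
    linear_graph L \<and> closure (Domain L) = UNIV \<and> adjoint_graph L = L"

definition bounded_below_by :: "'h::complex_hilbert graph_op \<Rightarrow> real \<Rightarrow> bool"
  where "bounded_below_by L c \<longleftrightarrow> (\<forall>(x, y) \<in> L. Re (cinner x y) \<ge> c * (norm x)\<^sup>2)"

definition everywhere_bounded :: "'h::complex_hilbert graph_op \<Rightarrow> bool"
  where "everywhere_bounded G \<longleftrightarrow> (\<exists>A :: ('h, 'h) blinfun. G = {(x, y). y = blinfun_apply A x})"

text \<open>Meaningful only for graphs satisfying \<open>everywhere_bounded\<close>.\<close>

definition to_blinfun :: "'h::complex_hilbert graph_op \<Rightarrow> ('h, 'h) blinfun"
  where "to_blinfun G = (THE A. G = {(x, y). y = blinfun_apply A x})"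


section \<open>Spectral measures and functional calculus\<close>

definition projection_valued_measure :: "(real set \<Rightarrow> ('h::complex_hilbert, 'h) blinfun) \<Rightarrow> bool"
  where "projection_valued_measure E \<longleftrightarrow>
    (\<forall>A \<in> sets borel. \<forall>x y. cinner (blinfun_apply (E A) x) y = cinner x (blinfun_apply (E A) y)) \<and>
    (\<forall>A \<in> sets borel. \<forall>B \<in> sets borel. E (A \<inter> B) = blinfun_compose (E A) (E B)) \<and>
    E UNIV = id_blinfun \<and>
    (\<forall>A :: nat \<Rightarrow> real set. range A \<subseteq> sets borel \<longrightarrow> disjoint_family A \<longrightarrow>
      (\<forall>x. (\<lambda>n. blinfun_apply (E (A n)) x) sums blinfun_apply (E (\<Union>n. A n)) x))"

definition spectral_weight ::
    "(real set \<Rightarrow> ('h::complex_hilbert, 'h) blinfun) \<Rightarrow> 'h \<Rightarrow> real measure"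
  where "spectral_weight E x =
    measure_of UNIV (sets borel) (\<lambda>A. ennreal (Re (cinner x (blinfun_apply (E A) x))))"

definition simple_spectral_integral ::
    "(real set \<Rightarrow> ('h::complex_hilbert, 'h) blinfun) \<Rightarrow> (real \<Rightarrow> real) \<Rightarrow> 'h \<Rightarrow> 'h"
  where "simple_spectral_integral E s x =
    (\<Sum>c \<in> range s. c *\<^sub>R blinfun_apply (E (s -` {c})) x)"

text \<open>
  The (possibly unbounded) operator \<open>\<integral> f dE\<close>. As simple functions are dense in \<open>L\<^sup>2\<close> of the finite
  measure \<open>spectral_weight E x\<close>, its domain consists of the \<open>x\<close> with \<open>f\<close> in that \<open>L\<^sup>2\<close> space; as
  \<open>s \<mapsto> simple_spectral_integral E s x\<close> is isometric from that \<open>L\<^sup>2\<close> space, the value does not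
  depend on the approximating sequence.
\<close>

definition spectral_integral ::
    "(real set \<Rightarrow> ('h::complex_hilbert, 'h) blinfun) \<Rightarrow> (real \<Rightarrow> real) \<Rightarrow> 'h graph_op"
  where "spectral_integral E f = {(x, y). f \<in> borel_measurable borel \<and>
    (\<exists>s :: nat \<Rightarrow> real \<Rightarrow> real. (\<forall>n. simple_function borel (s n)) \<and>
      (\<lambda>n. \<integral>\<^sup>+ u. ennreal ((f u - s n u)\<^sup>2) \<partial>spectral_weight E x) \<longlonglongrightarrow> 0 \<and>
      (\<lambda>n. simple_spectral_integral E (s n) x) \<longlonglongrightarrow> y)}"

definition is_spectral_measure ::
    "(real set \<Rightarrow> ('h::complex_hilbert, 'h) blinfun) \<Rightarrow> 'h graph_op \<Rightarrow> bool"
  where "is_spectral_measure E L \<longleftrightarrow>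
    projection_valued_measure E \<and> spectral_integral E (\<lambda>u. u) = L"

text \<open>
  By the spectral theorem a self-adjoint \<open>L\<close> has a spectral measure, unique on the Borel sets, so
  the choice is immaterial; \<open>0\<close> is a default value for operators that are not self-adjoint.
\<close>

definition spectral_measure ::
    "'h::complex_hilbert graph_op \<Rightarrow> real set \<Rightarrow> ('h, 'h) blinfun"
  where "spectral_measure L =
    (if \<exists>E. is_spectral_measure E L then SOME E. is_spectral_measure E L else (\<lambda>_. 0))"

definition op_fun :: "(real \<Rightarrow> real) \<Rightarrow> 'h::complex_hilbert graph_op \<Rightarrow> 'h graph_op"
  where "op_fun f L = spectral_integral (spectral_measure L) f"

definition op_exp :: "real \<Rightarrow> 'h::complex_hilbert graph_op \<Rightarrow> 'h graph_op"
  where "op_exp t L = op_fun (\<lambda>u. exp (t * u)) L"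

definition op_shift_powr :: "real \<Rightarrow> real \<Rightarrow> 'h::complex_hilbert graph_op \<Rightarrow> 'h graph_op"
    \<comment> \<open>\<open>(L + c I)\<^sup>a\<close>; on \<open>u + c < 0\<close> the value of \<open>powr\<close> is irrelevant when \<open>L + c I\<close> is positive\<close>
  where "op_shift_powr c a L = op_fun (\<lambda>u. (u + c) powr a) L"

abbreviation op_powr :: "real \<Rightarrow> 'h::complex_hilbert graph_op \<Rightarrow> 'h graph_op"
  where "op_powr \<equiv> op_shift_powr 0"


section \<open>Bochner integrals in arbitrary normed spaces\<close>

text \<open>
  Same definition as \<^const>\<open>has_bochner_integral\<close>, whose target type has to be second countable;
  bounded operators with the operator norm are not. Separability of the essential range
  follows from the approximation by simple functions.
\<close>

definition has_norm_bochner_integral ::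
    "'a measure \<Rightarrow> ('a \<Rightarrow> 'b::real_normed_vector) \<Rightarrow> 'b \<Rightarrow> bool"
  where "has_norm_bochner_integral M f I \<longleftrightarrow> f \<in> borel_measurable M \<and>
    (\<exists>s :: nat \<Rightarrow> 'a \<Rightarrow> 'b. (\<forall>i. Bochner_Integration.simple_bochner_integrable M (s i)) \<and>
      (\<lambda>i. \<integral>\<^sup>+ x. ennreal (norm (f x - s i x)) \<partial>M) \<longlonglongrightarrow> 0 \<and>
      (\<lambda>i. Bochner_Integration.simple_bochner_integral M (s i)) \<longlonglongrightarrow> I)"

definition norm_bochner_integrable :: "'a measure \<Rightarrow> ('a \<Rightarrow> 'b::real_normed_vector) \<Rightarrow> bool"
  where "norm_bochner_integrable M f \<longleftrightarrow> (\<exists>I. has_norm_bochner_integral M f I)"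

definition norm_bochner_integral :: "'a measure \<Rightarrow> ('a \<Rightarrow> 'b::real_normed_vector) \<Rightarrow> 'b"
  where "norm_bochner_integral M f = (THE I. has_norm_bochner_integral M f I)"


section \<open>The transverse integral\<close>

definition T_integrand ::
    "real \<Rightarrow> 'h::complex_hilbert graph_op \<Rightarrow> real ^ 'm \<Rightarrow> ('h, 'h) blinfun"
  where "T_integrand s L q =
    (1 / (2 * pi) ^ CARD('m)) *\<^sub>R to_blinfun (op_shift_powr ((norm q)\<^sup>2) (- s) L)"

definition T_op :: "'m::finite itself \<Rightarrow> real \<Rightarrow> 'h::complex_hilbert graph_op \<Rightarrow> ('h, 'h) blinfun"
  where "T_op _ s L = norm_bochner_integral lborel (T_integrand s L :: real ^ 'm \<Rightarrow> _)"

definition heat_integrand ::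
    "real \<Rightarrow> 'h::complex_hilbert graph_op \<Rightarrow> real \<Rightarrow> ('h, 'h) blinfun"
  where "heat_integrand a L t = (indicator {0<..} t * t powr a) *\<^sub>R to_blinfun (op_exp (- t) L)"

end

theory Submission
  imports Defs
begin

text \<open>
  Every operator in the theorem is a function of \<open>L\<close>, and the spectrum of \<open>L\<close> lies in \<open>{l..}\<close>; so the
  operator identities are the scalar identities
  \<open>\<integral> (v + |q|\<^sup>2) powr (-s) dq = pi powr (m/2) * Gamma (s - m/2) / Gamma s * v powr (m/2 - s)\<close> and
  \<open>\<integral> t powr (b - 1) * exp (-t v) dt = Gamma b * v powr (-b)\<close>, with \<open>b = s - m/2\<close>, read at every \<open>v \<ge> l\<close>
  and transported to \<open>L\<close>. The constant \<open>1 / (4 pi) powr (m/2)\<close> is \<open>pi powr (m/2) / (2 pi) ^ m\<close>.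

  What carries the transport is that the bounded functional calculus is a bounded linear map \<open>\<Phi>\<close> from
  the Banach space of bounded continuous functions on the line, with the sup norm, to the bounded
  operators (\<open>bounded_functional_calculus\<close>). A bounded linear map commutes with Bochner integrals
  (\<open>has_norm_bochner_integral_bounded_linear\<close>), so it is enough to integrate the curves
  \<open>q \<mapsto> (u \<mapsto> (u + |q|\<^sup>2) powr (-s))\<close> and \<open>t \<mapsto> (u \<mapsto> t powr (b - 1) * exp (-t u))\<close>, for \<open>t > 0\<close>, in the
  function space. There the integrals exist because the curves are continuous in the sup norm over
  \<open>{l..}\<close> and dominated by their values at \<open>u = l\<close> (\<open>norm_bochner_integrable_dominated_continuous\<close>),
  and they are identified by evaluating at single points, which leaves the scalar integrals
  (\<open>nn_integral_shifted_norm_powr\<close>, \<open>nn_integral_powr_exp\<close>). Functions on \<open>{l..}\<close> become functions on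
  the line by constant continuation to the left of \<open>l\<close>.

  The map \<open>\<Phi>\<close> is built from a spectral measure \<open>E\<close> of \<open>L\<close>: simple functions give finite sums of
  projections, the norm of such a sum is at most the supremum of the function over a set that carries
  \<open>E\<close>, and uniform limits do the rest. That \<open>E\<close> is carried by \<open>{l..}\<close> follows from
  \<open>bounded_below_by L l\<close>: a vector in the range of \<open>E {a..<b}\<close> with \<open>b < l\<close> would have an energy at most
  \<open>b\<close> and at least \<open>l\<close> times its squared norm. If \<open>L\<close> has no spectral measure, which the spectral theorem
  excludes for self-adjoint \<open>L\<close>, the default value makes every Borel function of \<open>L\<close> the zero operator,
  and the same statements hold with \<open>\<Phi> = 0\<close>.
\<close>

section \<open>Bochner integrals in non-separable spaces\<close>

text \<open>
  Without second countability the difference of two measurable functions need not be measurable.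
  Here it is enough to subtract the finitely many values of \<open>s\<close> one at a time.
\<close>

lemma borel_measurable_norm_diff_simple:
  fixes f :: "'a \<Rightarrow> 'b::real_normed_vector"
  assumes f: "f \<in> borel_measurable M" and s: "simple_function M s"
  shows "(\<lambda>x. norm (f x - s x)) \<in> borel_measurable M"
proof -
  have "(\<lambda>x. norm (f x - c)) \<in> borel_measurable M" for c
    by (rule measurable_compose[OF f]) (intro borel_measurable_continuous_onI continuous_intros)
  then show ?thesis
    by (rule measurable_compose_countable'[where I = "s ` space M" and g = s])
      (use s in \<open>auto simp: simple_function_def measurable_count_space_eq2 countable_finite\<close>)
qed

lemma norm_simple_bochner_integral_diff_le:
  fixes f :: "'a \<Rightarrow> 'b::real_normed_vector"
  assumes f: "f \<in> borel_measurable M"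
  assumes s: "Bochner_Integration.simple_bochner_integrable M s"
    and t: "Bochner_Integration.simple_bochner_integrable M t"
  shows "ennreal (norm (Bochner_Integration.simple_bochner_integral M s
      - Bochner_Integration.simple_bochner_integral M t)) \<le>
    (\<integral>\<^sup>+ x. norm (f x - s x) \<partial>M) + (\<integral>\<^sup>+ x. norm (f x - t x) \<partial>M)"
proof -
  have simple: "simple_function M s" "simple_function M t"
    using s t by (auto elim: Bochner_Integration.simple_bochner_integrable.cases)
  note [measurable] = borel_measurable_norm_diff_simple[OF f simple(1)]
    borel_measurable_norm_diff_simple[OF f simple(2)]
  have "ennreal (norm (Bochner_Integration.simple_bochner_integral M s
      - Bochner_Integration.simple_bochner_integral M t))
    = norm (Bochner_Integration.simple_bochner_integral M (\<lambda>x. s x - t x))"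
    using s t by (subst simple_bochner_integral_diff) auto
  also have "\<dots> \<le> Bochner_Integration.simple_bochner_integral M (\<lambda>x. norm (s x - t x))"
    using simple_bochner_integrable_compose2[of "(-)" M s t] s t
    by (auto intro!: simple_bochner_integral_norm_bound)
  also have "\<dots> = (\<integral>\<^sup>+x. norm (s x - t x) \<partial>M)"
    using simple_bochner_integrable_compose2[of "\<lambda>x y. norm (x - y)" M s t] s t
    by (auto intro!: simple_bochner_integral_eq_nn_integral)
  also have "\<dots> \<le> (\<integral>\<^sup>+x. ennreal (norm (f x - s x)) + ennreal (norm (f x - t x)) \<partial>M)"
    by (intro nn_integral_mono)
      (metis ennreal_leI ennreal_plus norm_ge_zero norm_diff_triangle_le norm_minus_commute order_refl)
  also have "\<dots> = (\<integral>\<^sup>+ x. norm (f x - s x) \<partial>M) + (\<integral>\<^sup>+ x. norm (f x - t x) \<partial>M)"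
    by (rule nn_integral_add) auto
  finally show ?thesis .
qed

lemma has_norm_bochner_integral_unique:
  assumes I: "has_norm_bochner_integral M f I" and J: "has_norm_bochner_integral M f J"
  shows "I = J"
proof -
  obtain s where f: "f \<in> borel_measurable M"
    and s: "\<And>i. Bochner_Integration.simple_bochner_integrable M (s i)"
      "(\<lambda>i. \<integral>\<^sup>+ x. ennreal (norm (f x - s i x)) \<partial>M) \<longlonglongrightarrow> 0"
      "(\<lambda>i. Bochner_Integration.simple_bochner_integral M (s i)) \<longlonglongrightarrow> I"
    using I unfolding has_norm_bochner_integral_def by blast
  obtain t where t: "\<And>i. Bochner_Integration.simple_bochner_integrable M (t i)"
      "(\<lambda>i. \<integral>\<^sup>+ x. ennreal (norm (f x - t i x)) \<partial>M) \<longlonglongrightarrow> 0"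
      "(\<lambda>i. Bochner_Integration.simple_bochner_integral M (t i)) \<longlonglongrightarrow> J"
    using J unfolding has_norm_bochner_integral_def by blast
  let ?d = "\<lambda>i. ennreal (norm (Bochner_Integration.simple_bochner_integral M (s i)
      - Bochner_Integration.simple_bochner_integral M (t i)))"
  have "?d \<longlonglongrightarrow> ennreal (norm (I - J))"
    by (intro tendsto_intros s t)
  moreover have "?d \<longlonglongrightarrow> 0"
  proof (rule tendsto_sandwich[OF _ _ tendsto_const])
    show "\<forall>\<^sub>F i in sequentially. ?d i \<le> (\<integral>\<^sup>+ x. norm (f x - s i x) \<partial>M) + (\<integral>\<^sup>+ x. norm (f x - t i x) \<partial>M)"
      by (intro always_eventually allI norm_simple_bochner_integral_diff_le f s t)
    show "(\<lambda>i. (\<integral>\<^sup>+ x. norm (f x - s i x) \<partial>M) + (\<integral>\<^sup>+ x. norm (f x - t i x) \<partial>M)) \<longlonglongrightarrow> 0"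
      using tendsto_add[OF s(2) t(2)] by simp
  qed auto
  ultimately have "ennreal (norm (I - J)) = 0"
    by (rule LIMSEQ_unique)
  then show ?thesis
    by simp
qed

lemma norm_bochner_integral_eq:
  "has_norm_bochner_integral M f I \<Longrightarrow> norm_bochner_integral M f = I"
  unfolding norm_bochner_integral_def by (blast intro: has_norm_bochner_integral_unique)

lemma norm_bochner_integrableI_sequence:
  fixes f :: "'a \<Rightarrow> 'b::{real_normed_vector, complete_space}"
  assumes f: "f \<in> borel_measurable M"
    and s: "\<And>i. Bochner_Integration.simple_bochner_integrable M (s i)"
    and lim: "(\<lambda>i. \<integral>\<^sup>+ x. ennreal (norm (f x - s i x)) \<partial>M) \<longlonglongrightarrow> 0" (is "?S \<longlonglongrightarrow> 0")
  shows "norm_bochner_integrable M f"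
proof -
  let ?s = "\<lambda>n. Bochner_Integration.simple_bochner_integral M (s n)"
  have "Cauchy ?s"
  proof (rule metric_CauchyI)
    fix e :: real assume "0 < e"
    then have "0 < ennreal (e / 2)" by auto
    from order_tendstoD(2)[OF lim this]
    obtain N where N: "\<And>n. N \<le> n \<Longrightarrow> ?S n < e / 2"
      by (auto simp: eventually_sequentially)
    have "dist (?s m) (?s n) < e" if "N \<le> m" "N \<le> n" for m n
    proof -
      have "norm (?s m - ?s n) \<le> ?S m + ?S n"
        by (intro norm_simple_bochner_integral_diff_le s f)
      also have "\<dots> < ennreal (e / 2) + e / 2"
        by (intro add_strict_mono N that)
      also have "\<dots> = e"
        using \<open>0 < e\<close> by (simp flip: ennreal_plus)
      finally show ?thesis
        using \<open>0 < e\<close> by (simp add: dist_norm ennreal_less_iff)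
    qed
    then show "\<exists>N. \<forall>m\<ge>N. \<forall>n\<ge>N. dist (?s m) (?s n) < e" by blast
  qed
  then obtain I where "?s \<longlonglongrightarrow> I"
    using Cauchy_convergent_iff convergent_def by blast
  with f s lim show ?thesis
    unfolding norm_bochner_integrable_def has_norm_bochner_integral_def by blast
qed

lemma has_norm_bochner_integral_bounded_linear:
  assumes T: "bounded_linear T" and I: "has_norm_bochner_integral M f I"
  shows "has_norm_bochner_integral M (\<lambda>x. T (f x)) (T I)"
proof -
  interpret T: bounded_linear T by fact
  obtain K where K: "K \<ge> 0" "\<And>x. norm (T x) \<le> K * norm x"
    using T.nonneg_bounded by (metis mult.commute)
  obtain s where f: "f \<in> borel_measurable M"
    and s: "\<And>i. Bochner_Integration.simple_bochner_integrable M (s i)"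
      "(\<lambda>i. \<integral>\<^sup>+ x. ennreal (norm (f x - s i x)) \<partial>M) \<longlonglongrightarrow> 0"
      "(\<lambda>i. Bochner_Integration.simple_bochner_integral M (s i)) \<longlonglongrightarrow> I"
    using I unfolding has_norm_bochner_integral_def by blast
  have simple: "simple_function M (s i)" for i
    using s(1) by (auto elim: Bochner_Integration.simple_bochner_integrable.cases)
  note meas = borel_measurable_norm_diff_simple[OF f simple]
  show ?thesis
    unfolding has_norm_bochner_integral_def
  proof (intro conjI exI[where x = "\<lambda>i x. T (s i x)"] allI)
    show "(\<lambda>x. T (f x)) \<in> borel_measurable M"
      by (rule measurable_compose[OF f])
        (intro borel_measurable_continuous_onI linear_continuous_on T)
    show "Bochner_Integration.simple_bochner_integrable M (\<lambda>x. T (s i x))" for i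
      using simple_bochner_integrable_compose2[of "\<lambda>x _. T x" M "s i" "s i"] s(1) T.zero by simp
    show "(\<lambda>i. Bochner_Integration.simple_bochner_integral M (\<lambda>x. T (s i x))) \<longlonglongrightarrow> T I"
      using T.tendsto[OF s(3)] by (simp add: simple_bochner_integral_linear[OF T.linear s(1)])
    show "(\<lambda>i. \<integral>\<^sup>+ x. ennreal (norm (T (f x) - T (s i x))) \<partial>M) \<longlonglongrightarrow> 0"
    proof (rule tendsto_sandwich[OF _ _ tendsto_const])
      show "\<forall>\<^sub>F i in sequentially. (\<integral>\<^sup>+ x. ennreal (norm (T (f x) - T (s i x))) \<partial>M)
          \<le> ennreal K * (\<integral>\<^sup>+ x. ennreal (norm (f x - s i x)) \<partial>M)"
        by (intro always_eventually allI, subst nn_integral_cmult[symmetric])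
          (use meas K in \<open>auto intro!: nn_integral_mono simp: ennreal_mult'[symmetric] T.diff[symmetric]
            intro!: ennreal_leI\<close>)
      show "(\<lambda>i. ennreal K * (\<integral>\<^sup>+ x. ennreal (norm (f x - s i x)) \<partial>M)) \<longlonglongrightarrow> 0"
        using ennreal_tendsto_cmult[OF _ s(2), of "ennreal K"] by simp
    qed auto
  qed
qed

lemma has_norm_bochner_integral_imp_has_bochner_integral:
  fixes f :: "'a \<Rightarrow> 'b::{real_normed_vector, second_countable_topology}"
  assumes "has_norm_bochner_integral M f I"
  shows "has_bochner_integral M f I"
  using assms unfolding has_norm_bochner_integral_def
  by (auto intro: has_bochner_integral.intros)

text \<open>
  The domain is second countable even when the target is not, so \<open>F\<close> is approximated by \<open>F \<circ> r i\<close>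
  with simple \<open>r i\<close> converging to the identity. Where \<open>r i x\<close> is still far from \<open>x\<close>, this may be far too
  large; replacing it by \<open>0\<close> wherever its norm exceeds \<open>2 * norm (F x)\<close> keeps the pointwise convergence
  and makes \<open>3 * norm (F x)\<close> a dominating function. Allowing an open \<open>U\<close> covers integrands with a
  singularity on the boundary, such as \<open>t powr a\<close> at \<open>0\<close>.
\<close>

lemma norm_bochner_integrable_dominated_continuous:
  fixes F :: "'a::euclidean_space \<Rightarrow> 'b::{real_normed_vector, complete_space}" and g :: "'a \<Rightarrow> real"
  assumes U: "open U" and cont: "continuous_on U F" and zero: "\<And>x. x \<notin> U \<Longrightarrow> F x = 0"
    and g: "integrable lborel g" and le: "\<And>x. x \<in> U \<Longrightarrow> norm (F x) \<le> g x"
  shows "norm_bochner_integrable lborel F"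
proof -
  have "(\<lambda>x. indicator U x *\<^sub>R norm (F x)) \<in> borel_measurable borel"
    by (rule borel_measurable_continuous_on_indicator)
      (use U cont in \<open>auto intro!: continuous_intros\<close>)
  also have "(\<lambda>x. indicator U x *\<^sub>R norm (F x)) = (\<lambda>x. norm (F x))"
    using zero by (fastforce simp: indicator_def)
  finally have meas[measurable]: "(\<lambda>x. norm (F x)) \<in> borel_measurable borel" .

  have "norm (F x) \<le> norm (g x)" for x
    by (cases "x \<in> U") (use le zero in \<open>force+\<close>)
  then have "integrable lborel (\<lambda>x. norm (F x))"
    by (intro Bochner_Integration.integrable_bound[OF g]) auto
  then have fin: "(\<integral>\<^sup>+ x. ennreal (norm (F x)) \<partial>lborel) < \<infinity>"
    by (simp add: integrable_iff_bounded)

  obtain r :: "nat \<Rightarrow> 'a \<Rightarrow> 'a" where r: "\<And>i. simple_function lborel (r i)" "\<And>x. (\<lambda>i. r i x) \<longlonglongrightarrow> x"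
    using borel_measurable_implies_sequence_metric[of "\<lambda>x. x" "lborel :: 'a measure" 0] by auto
  define s where "s i x = (if norm (F (r i x)) \<le> 2 * norm (F x) then F (r i x) else 0)" for i x
  have s_le: "norm (s i x) \<le> 2 * norm (F x)" for i x
    by (simp add: s_def)
  have simple: "simple_function lborel (s i)" for i
  proof -
    have "simple_function lborel (\<lambda>x. F (r i x))" "simple_function lborel (\<lambda>x. norm (F (r i x)))"
      by (rule simple_function_compose1[OF r(1)])+
    moreover from this have [measurable]: "(\<lambda>x. norm (F (r i x))) \<in> borel_measurable borel"
      using borel_measurable_simple_function by force
    ultimately show ?thesis
      unfolding s_def by (intro simple_function_If) auto
  qed
  have s_lim: "(\<lambda>i. s i x) \<longlonglongrightarrow> F x" for x
  proof (cases "F x = 0")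
    case True
    then have "s i x = 0" for i
      using s_le[of i x] by simp
    with True show ?thesis by simp
  next
    case False
    then have "x \<in> U" using zero by blast
    then have lim: "(\<lambda>i. F (r i x)) \<longlonglongrightarrow> F x"
      using U cont r(2) by (metis continuous_on_eq_continuous_at isCont_tendsto_compose)
    then have "(\<lambda>i. norm (F (r i x))) \<longlonglongrightarrow> norm (F x)"
      by (rule tendsto_norm)
    then have "\<forall>\<^sub>F i in sequentially. norm (F (r i x)) < 2 * norm (F x)"
      by (rule order_tendstoD) (use False in simp)
    then have "\<forall>\<^sub>F i in sequentially. F (r i x) = s i x"
      by eventually_elim (simp add: s_def)
    with lim show ?thesis
      by (rule Lim_transform_eventually)
  qed
  have meas_F: "F \<in> borel_measurable lborel"
    by (rule borel_measurable_LIMSEQ_metric[OF borel_measurable_simple_function[OF simple] s_lim])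
  \<comment> \<open>\<open>s i\<close> has finitely many values, so where it is non-zero, \<open>norm (F x)\<close> is bounded away from \<open>0\<close>;
    Markov's inequality then bounds the measure of the support.\<close>
  have "emeasure lborel {x. s i x \<noteq> 0} \<noteq> \<infinity>" for i
  proof (cases "range (s i) \<subseteq> {0}")
    case True
    then have "{x. s i x \<noteq> 0} = {}" by auto
    then show ?thesis by simp
  next
    case False
    define m where "m = Min (norm ` (range (s i) - {0}))"
    have finite: "finite (norm ` (range (s i) - {0}))"
      using simple[of i] by (simp add: simple_function_def)
    then have "m \<in> norm ` (range (s i) - {0})"
      unfolding m_def using False by (intro Min_in) auto
    then have "m > 0" by auto
    have "m \<le> 2 * norm (F x)" if "s i x \<noteq> 0" for x
      using s_le[of i x] Min_le[OF finite, of "norm (s i x)"] that unfolding m_def by force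
    then have "emeasure lborel {x. s i x \<noteq> 0}
        \<le> emeasure lborel ({x \<in> UNIV. 1 \<le> ennreal (2 / m) * ennreal (norm (F x))} \<inter> UNIV)"
      using \<open>m > 0\<close>
      by (intro emeasure_mono) (auto simp: ennreal_mult'[symmetric] field_simps)
    also have "\<dots> \<le> ennreal (2 / m) * (\<integral>\<^sup>+ x. ennreal (norm (F x)) * indicator UNIV x \<partial>lborel)"
      using nn_integral_Markov_inequality[of "\<lambda>x. ennreal (norm (F x))" UNIV lborel "ennreal (2/m)"]
      by auto
    also have "\<dots> < \<infinity>"
      using fin by (simp add: ennreal_mult_less_top)
    finally show ?thesis by simp
  qed
  then have sbi: "Bochner_Integration.simple_bochner_integrable lborel (s i)" for i
    using simple by (auto intro!: simple_bochner_integrable.intros)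
  have "(\<lambda>i. \<integral>\<^sup>+ x. ennreal (norm (F x - s i x)) \<partial>lborel) \<longlonglongrightarrow> (\<integral>\<^sup>+ x. 0 \<partial>(lborel :: 'a measure))"
  proof (rule nn_integral_dominated_convergence[where w = "\<lambda>x. ennreal 3 * ennreal (norm (F x))"])
    show "(\<lambda>x. ennreal (norm (F x - s i x))) \<in> borel_measurable lborel" for i
      using borel_measurable_norm_diff_simple[OF meas_F simple] by simp
    have "norm (F x - s i x) \<le> 3 * norm (F x)" for i x
      using norm_triangle_ineq4[of "F x" "s i x"] s_le[of i x] by linarith
    then show "AE x in lborel. ennreal (norm (F x - s i x)) \<le> ennreal 3 * ennreal (norm (F x))" for i
      by (intro AE_I2) (metis ennreal_leI ennreal_mult' zero_le_numeral)
    show "(\<integral>\<^sup>+ x. ennreal 3 * ennreal (norm (F x)) \<partial>lborel) < \<infinity>"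
      using fin by (simp add: nn_integral_cmult ennreal_mult_less_top)
    have "(\<lambda>i. norm (F x - s i x)) \<longlonglongrightarrow> 0" for x
      using tendsto_norm[OF tendsto_diff[OF tendsto_const[of "F x"] s_lim[of x]]] by simp
    then show "AE x in lborel. (\<lambda>i. ennreal (norm (F x - s i x))) \<longlonglongrightarrow> 0"
      by (intro AE_I2) (metis tendsto_ennrealI ennreal_0)
  qed auto
  then show ?thesis
    using norm_bochner_integrableI_sequence[OF meas_F sbi] by simp
qed


section \<open>The scalar integrals\<close>

lemma nn_integral_powr_exp:
  fixes b v :: real
  assumes b: "b > 0" and v: "v > 0"
  shows "(\<integral>\<^sup>+ t. ennreal (indicator {0<..} t * t powr (b - 1) * exp (- t * v)) \<partial>lborel)
    = ennreal (Gamma b * v powr (- b))"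
proof -
  let ?f = "\<lambda>t::real. indicator {0..} t * t powr (b - 1) / exp t"
  have *: "indicator {0<..} t * t powr (b - 1) * exp (- t * v) * v powr b = v * ?f (0 + v * t)" for t :: real
    using v by (auto simp: indicator_def powr_mult exp_minus powr_diff field_simps zero_le_mult_iff)
  have "ennreal (Gamma b) = (\<integral>\<^sup>+ t. ennreal (?f t) \<partial>lborel)"
    by (rule Gamma_conv_nn_integral_real[OF b])
  also have "\<dots> = ennreal v * (\<integral>\<^sup>+ t. ennreal (?f (0 + v * t)) \<partial>lborel)"
    using v by (subst nn_integral_real_affine[where t = 0 and c = v]) auto
  also have "\<dots> = (\<integral>\<^sup>+ t. ennreal (v * ?f (0 + v * t)) \<partial>lborel)"
    unfolding ennreal_mult'[OF less_imp_le[OF v]] by (rule nn_integral_cmult[symmetric]) measurable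
  also have "\<dots> = (\<integral>\<^sup>+ t. ennreal (indicator {0<..} t * t powr (b - 1) * exp (- t * v))
      * ennreal (v powr b) \<partial>lborel)"
    by (subst *[symmetric]) (simp add: ennreal_mult'')
  also have "\<dots> = (\<integral>\<^sup>+ t. ennreal (indicator {0<..} t * t powr (b - 1) * exp (- t * v)) \<partial>lborel)
      * ennreal (v powr b)"
    by (subst nn_integral_multc) auto
  finally have "ennreal (Gamma b) * ennreal (v powr (-b)) =
      (\<integral>\<^sup>+ t. ennreal (indicator {0<..} t * t powr (b - 1) * exp (- t * v)) \<partial>lborel)
      * (ennreal (v powr b) * ennreal (v powr (-b)))"
    by (simp add: mult.assoc)
  also have "ennreal (v powr b) * ennreal (v powr (-b)) = 1"
    using v by (simp add: ennreal_mult'[symmetric] powr_add[symmetric])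
  finally show ?thesis
    by (simp add: ennreal_mult'')
qed

text \<open>
  Layer cake: \<open>exp (-t * a)\<close> is the integral of \<open>t * exp (-t * r)\<close> over \<open>r \<ge> a\<close>, so exchanging the
  integrals replaces the Gaussian by the volume of the ball of radius \<open>sqrt r\<close>, and the remaining
  integral over \<open>r\<close> is a Gamma integral that cancels the \<open>Gamma (d/2 + 1)\<close> in the volume of the
  unit ball.
\<close>

lemma nn_integral_gaussian:
  fixes t :: real
  assumes t: "t > 0"
  shows "(\<integral>\<^sup>+ q. ennreal (exp (- t * (norm q)\<^sup>2)) \<partial>(lborel :: 'a::euclidean_space measure))
    = ennreal (pi powr (DIM('a) / 2) * t powr (- (DIM('a) / 2)))"
proof -
  let ?d = "real DIM('a) / 2"
  have tail: "ennreal (exp (- t * a)) = (\<integral>\<^sup>+ r. ennreal (t * exp (- t * r)) * indicator {a..} r \<partial>lborel)"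
    for a :: real
  proof -
    have "((\<lambda>r. - exp (- t * r)) \<longlongrightarrow> - 0) at_top"
      using t by (intro tendsto_intros filterlim_compose[OF exp_at_bot]
          filterlim_tendsto_neg_mult_at_bot[OF tendsto_const]) (auto simp: filterlim_ident)
    then have "(\<integral>\<^sup>+ r. ennreal (t * exp (- t * r)) * indicator {a..} r \<partial>lborel) = ennreal (- 0 - (- exp (- t * a)))"
      using t by (intro nn_integral_FTC_atLeast) (auto intro!: derivative_eq_intros)
    then show ?thesis by simp
  qed
  have meas: "(\<lambda>(q::'a, r). ennreal (t * exp (- t * r)) * indicator {(norm q)\<^sup>2..} r)
      \<in> borel_measurable (lborel \<Otimes>\<^sub>M lborel)"
  proof -
    have "(\<lambda>(q::'a, r). ennreal (t * exp (- t * r)) * indicator {(q, r). (norm q)\<^sup>2 \<le> r} (q, r))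
        \<in> borel_measurable (lborel \<Otimes>\<^sub>M lborel)"
      by measurable
    then show ?thesis
      by (simp add: indicator_def)
  qed
  have ball: "(\<integral>\<^sup>+ q. indicator {(norm q)\<^sup>2..} r \<partial>(lborel :: 'a measure))
      = ennreal (unit_ball_vol DIM('a) * r powr ?d)" if "r > 0" for r
  proof -
    have "(\<integral>\<^sup>+ q. indicator {(norm q)\<^sup>2..} r \<partial>(lborel :: 'a measure))
        = (\<integral>\<^sup>+ q. indicator (cball 0 (sqrt r)) q \<partial>(lborel :: 'a measure))"
      by (intro nn_integral_cong)
        (use that in \<open>auto simp: indicator_def real_le_rsqrt real_sqrt_le_iff' intro: sqrt_ge_absD\<close>)
    also have "\<dots> = ennreal (unit_ball_vol DIM('a) * sqrt r ^ DIM('a))"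
      using that by (simp add: emeasure_cball)
    also have "sqrt r ^ DIM('a) = r powr ?d"
      using that by (simp add: powr_half_sqrt[symmetric] powr_powr flip: powr_realpow)
    finally show ?thesis .
  qed
  have "(\<integral>\<^sup>+ q. ennreal (exp (- t * (norm q)\<^sup>2)) \<partial>(lborel :: 'a measure))
      = (\<integral>\<^sup>+ q. \<integral>\<^sup>+ r. ennreal (t * exp (- t * r)) * indicator {(norm q)\<^sup>2..} r \<partial>lborel \<partial>(lborel :: 'a measure))"
    by (simp only: tail)
  also have "\<dots> = (\<integral>\<^sup>+ r. \<integral>\<^sup>+ q. ennreal (t * exp (- t * r)) * indicator {(norm q)\<^sup>2..} r \<partial>(lborel :: 'a measure) \<partial>lborel)"
    using lborel_pair.Fubini'[OF meas] by simp
  also have "\<dots> = (\<integral>\<^sup>+ r. ennreal (unit_ball_vol DIM('a) * t)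
      * ennreal (indicator {0<..} r * r powr ((?d + 1) - 1) * exp (- r * t)) \<partial>lborel)"
  proof (intro nn_integral_cong_AE)
    show "AE r in lborel. (\<integral>\<^sup>+ q. ennreal (t * exp (- t * r)) * indicator {(norm q)\<^sup>2..} r \<partial>(lborel :: 'a measure))
      = ennreal (unit_ball_vol DIM('a) * t) * ennreal (indicator {0<..} r * r powr ((?d + 1) - 1) * exp (- r * t))"
      using AE_lborel_singleton[of "0::real"]
    proof eventually_elim
      case (elim r)
      show ?case
      proof (cases "r > 0")
        case True
        have "(\<integral>\<^sup>+ q. ennreal (t * exp (- t * r)) * indicator {(norm q)\<^sup>2..} r \<partial>(lborel :: 'a measure))
          = ennreal (t * exp (- t * r)) * (\<integral>\<^sup>+ q. indicator {(norm q)\<^sup>2..} r \<partial>(lborel :: 'a measure))"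
          by (rule nn_integral_cmult) (simp add: indicator_def)
        then show ?thesis
          using True t by (simp add: ball ennreal_mult'[symmetric] mult_ac)
      next
        case False
        with elim have "\<not> (norm q)\<^sup>2 \<le> r" for q :: 'a
          by (smt (verit) zero_le_power2)
        with False show ?thesis by (simp add: indicator_def)
      qed
    qed
  qed
  also have "\<dots> = ennreal (unit_ball_vol DIM('a) * t) * ennreal (Gamma (?d + 1) * t powr (- (?d + 1)))"
    by (subst nn_integral_cmult, measurable, subst nn_integral_powr_exp) (use t in \<open>simp_all add: add_nonneg_pos\<close>)
  also have "\<dots> = ennreal (pi powr ?d * t powr (- ?d))"
  proof -
    have "Gamma (?d + 1) > 0"
      by (intro Gamma_real_pos add_nonneg_pos) auto
    then have "Gamma (?d + 1) \<noteq> 0" by (metis less_irrefl)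
    then have "unit_ball_vol DIM('a) * t * (Gamma (?d + 1) * t powr (- (?d + 1))) = pi powr ?d * t powr (- ?d)"
    proof -
      have "- (?d + 1) = - ?d + (- 1)" by simp
      then have "t powr (- (?d + 1)) = t powr (- ?d) * inverse t"
        using t by (metis powr_add powr_neg_one inverse_eq_divide)
      with t \<open>Gamma (?d + 1) \<noteq> 0\<close> show ?thesis
        unfolding unit_ball_vol_def by simp
    qed
    then show ?thesis
      using t by (simp add: ennreal_mult'[symmetric])
  qed
  finally show ?thesis .
qed

text \<open>
  The negative power is a Gamma integral over \<open>t\<close> of \<open>exp (-t * (v + |q|\<^sup>2))\<close>. Integrating the
  Gaussian in \<open>q\<close> first costs a factor \<open>(pi / t) powr (d/2)\<close>, which lowers the exponent of \<open>t\<close> and leaves another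
  Gamma integral.
\<close>

lemma nn_integral_shifted_norm_powr:
  fixes v s :: real
  assumes v: "v > 0" and s: "s > DIM('a) / 2"
  shows "(\<integral>\<^sup>+ q. ennreal ((v + (norm q)\<^sup>2) powr (- s)) \<partial>(lborel :: 'a::euclidean_space measure))
    = ennreal (pi powr (DIM('a) / 2) * (Gamma (s - DIM('a) / 2) / Gamma s) * v powr (DIM('a) / 2 - s))"
proof -
  let ?d = "real DIM('a) / 2"
  have s0: "s > 0" using s by (smt (verit) divide_nonneg_nonneg of_nat_0_le_iff)
  have G: "Gamma s > 0" using s0 by (rule Gamma_real_pos)
  let ?k = "\<lambda>t. indicator {0<..} t * t powr (s - 1) * exp (- t * v)"
  have 1: "(\<integral>\<^sup>+ t. ennreal (?k t) * ennreal (exp (- t * (norm q)\<^sup>2)) \<partial>lborel)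
      = ennreal (Gamma s) * ennreal ((v + (norm q)\<^sup>2) powr (- s))" for q :: 'a
  proof -
    have "(\<integral>\<^sup>+ t. ennreal (?k t) * ennreal (exp (- t * (norm q)\<^sup>2)) \<partial>lborel)
        = (\<integral>\<^sup>+ t. ennreal (indicator {0<..} t * t powr (s - 1) * exp (- t * (v + (norm q)\<^sup>2))) \<partial>lborel)"
      by (intro nn_integral_cong) (simp add: ennreal_mult''[symmetric] ring_distribs exp_add exp_diff exp_minus field_simps)
    also have "\<dots> = ennreal (Gamma s * (v + (norm q)\<^sup>2) powr (- s))"
      using v s0 by (intro nn_integral_powr_exp) (auto intro: add_pos_nonneg)
    finally show ?thesis
      using G by (simp add: ennreal_mult')
  qed
  have 2: "(\<integral>\<^sup>+ q. ennreal (?k t) * ennreal (exp (- t * (norm q)\<^sup>2)) \<partial>(lborel :: 'a measure))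
      = ennreal (pi powr ?d) * ennreal (indicator {0<..} t * t powr ((s - ?d) - 1) * exp (- t * v))" for t
  proof (cases "t > 0")
    case True
    have "(\<integral>\<^sup>+ q. ennreal (?k t) * ennreal (exp (- t * (norm q)\<^sup>2)) \<partial>(lborel :: 'a measure))
      = ennreal (?k t) * (\<integral>\<^sup>+ q. ennreal (exp (- t * (norm q)\<^sup>2)) \<partial>(lborel :: 'a measure))"
      by (rule nn_integral_cmult) simp
    also have "\<dots> = ennreal (?k t * (pi powr ?d * t powr (- ?d)))"
      using True by (subst nn_integral_gaussian) (auto simp: ennreal_mult'' intro!: ennreal_mult''[symmetric])
    also have "?k t * (pi powr ?d * t powr (- ?d)) = pi powr ?d * (indicator {0<..} t * t powr ((s - ?d) - 1) * exp (- t * v))"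
    proof -
      have "(s - ?d) - 1 = (s - 1) + (- ?d)" by simp
      then have "t powr ((s - ?d) - 1) = t powr (s - 1) * t powr (- ?d)"
        by (metis powr_add)
      with True show ?thesis by (simp del: of_nat_diff)
    qed
    finally show ?thesis by (simp add: ennreal_mult')
  qed simp
  have "ennreal (Gamma s) * (\<integral>\<^sup>+ q. ennreal ((v + (norm q)\<^sup>2) powr (- s)) \<partial>(lborel :: 'a measure))
    = (\<integral>\<^sup>+ q. \<integral>\<^sup>+ t. ennreal (?k t) * ennreal (exp (- t * (norm q)\<^sup>2)) \<partial>lborel \<partial>(lborel :: 'a measure))"
    by (simp only: 1) (rule nn_integral_cmult[symmetric], simp)
  also have "\<dots> = (\<integral>\<^sup>+ t. \<integral>\<^sup>+ q. ennreal (?k t) * ennreal (exp (- t * (norm q)\<^sup>2)) \<partial>(lborel :: 'a measure) \<partial>lborel)"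
    by (rule lborel_pair.Fubini'[symmetric]) measurable
  also have "\<dots> = ennreal (pi powr ?d) * ennreal (Gamma (s - ?d) * v powr (- (s - ?d)))"
    by (simp only: 2, subst nn_integral_cmult) (use s v in \<open>simp_all only: nn_integral_powr_exp, auto\<close>)
  finally have "ennreal (1 / Gamma s) * (ennreal (Gamma s)
      * (\<integral>\<^sup>+ q. ennreal ((v + (norm q)\<^sup>2) powr (- s)) \<partial>(lborel :: 'a measure)))
    = ennreal (1 / Gamma s) * (ennreal (pi powr ?d) * ennreal (Gamma (s - ?d) * v powr (- (s - ?d))))"
    by simp
  then show ?thesis
    using G by (simp add: mult.assoc[symmetric] ennreal_mult'[symmetric] ennreal_mult''[symmetric])
qed


section \<open>Bounded functional calculus of an operator bounded below\<close>

context
  fixes E :: "real set \<Rightarrow> ('h::complex_hilbert, 'h) blinfun"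
  assumes E: "projection_valued_measure E"
begin

lemma pvm_symmetric: "A \<in> sets borel \<Longrightarrow> inner (E A x) y = inner x (E A y)"
  using E unfolding projection_valued_measure_def by (metis Re_cinner)

lemma pvm_Int: "A \<in> sets borel \<Longrightarrow> B \<in> sets borel \<Longrightarrow> E (A \<inter> B) x = E A (E B x)"
  using E unfolding projection_valued_measure_def by (metis blinfun_apply_blinfun_compose)

lemma pvm_UNIV: "E UNIV = id_blinfun"
  using E unfolding projection_valued_measure_def by blast

lemma pvm_sums:
  "range A \<subseteq> sets borel \<Longrightarrow> disjoint_family A \<Longrightarrow> (\<lambda>n::nat. E (A n) x) sums E (\<Union>n. A n) x"
  using E unfolding projection_valued_measure_def by blast

lemma pvm_empty: "E {} = 0"
proof (rule blinfun_eqI)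
  fix x
  have "(\<lambda>n::nat. E {} x) sums E (\<Union>n::nat. {}) x"
    by (rule pvm_sums) (auto simp: disjoint_family_on_def)
  then show "E {} x = blinfun_apply 0 x"
    by (auto dest: sums_summable simp: summable_const_iff)
qed

lemma pvm_Un:
  assumes "A \<in> sets borel" "B \<in> sets borel" "A \<inter> B = {}"
  shows "E (A \<union> B) = E A + E B"
proof (rule blinfun_eqI)
  fix x
  define D where "D n = (if n = 0 then A else if n = 1 then B else {})" for n :: nat
  have "(\<lambda>n. E (D n) x) sums E (\<Union>n. D n) x"
    by (rule pvm_sums) (use assms in \<open>auto simp: disjoint_family_on_def D_def\<close>)
  moreover have "(\<Union>n. D n) = A \<union> B"
    unfolding D_def by (auto split: if_splits)
  moreover have "(\<lambda>n. E (D n) x) sums (\<Sum>n\<in>{0, 1}. E (D n) x)"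
    by (rule sums_finite) (auto simp: D_def pvm_empty)
  ultimately show "E (A \<union> B) x = (E A + E B) x"
    by (auto simp: D_def blinfun.add_left dest: sums_unique2)
qed

lemma pvm_UN_finite:
  assumes "finite I" "\<And>i. i \<in> I \<Longrightarrow> A i \<in> sets borel" "disjoint_family_on A I"
  shows "E (\<Union>i\<in>I. A i) = (\<Sum>i\<in>I. E (A i))"
  using assms
proof (induction I rule: finite_induct)
  case (insert i I)
  have "A i \<inter> (\<Union>j\<in>I. A j) = {}"
    using insert.hyps insert.prems(2) by (fastforce simp: disjoint_family_on_def)
  moreover have "(\<Union>j\<in>I. A j) \<in> sets borel"
    using insert.hyps insert.prems(1) by auto
  moreover have "E (\<Union>j\<in>I. A j) = (\<Sum>j\<in>I. E (A j))"
    using insert.prems by (intro insert.IH) (auto simp: disjoint_family_on_def)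
  ultimately show ?case
    using insert.hyps insert.prems(1) by (simp add: pvm_Un)
qed (simp add: pvm_empty)

lemma pvm_norm_sq: "A \<in> sets borel \<Longrightarrow> inner x (E A x) = (norm (E A x))\<^sup>2"
  by (metis Int_absorb pvm_Int pvm_symmetric power2_norm_eq_inner)

lemma pvm_norm_le:
  assumes "A \<in> sets borel"
  shows "norm (E A x) \<le> norm x"
proof -
  have "norm (E A x) * norm (E A x) \<le> norm x * norm (E A x)"
    using pvm_norm_sq[OF assms, of x] norm_cauchy_schwarz[of x "E A x"] by (simp add: power2_eq_square)
  then show ?thesis
    by (metis mult_right_le_imp_le norm_ge_zero order_le_less)
qed


text \<open>
  The operator \<open>simple_spectral_integral E s\<close>, as an element of the Banach space of bounded operators.
\<close>

definition simple_op :: "(real \<Rightarrow> real) \<Rightarrow> ('h, 'h) blinfun"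
  where "simple_op s = (\<Sum>c\<in>range s. c *\<^sub>R E (s -` {c}))"

lemma simple_spectral_integral_eq: "simple_spectral_integral E s x = simple_op s x"
  by (simp add: simple_spectral_integral_def simple_op_def blinfun.sum_left blinfun.scaleR_left)

lemma simple_function_borelD:
  assumes "simple_function borel s"
  shows "finite (range s)" "s -` B \<in> sets borel"
  using simple_functionD[OF assms] by auto

text \<open>
  The preimages of the values of \<open>s\<close> may be split further without changing the operator. For two simple
  functions the values of their pair give a common refinement.
\<close>

lemma simple_op_partition:
  assumes p: "simple_function borel p"
  shows "simple_op (\<lambda>u. h (p u)) = (\<Sum>v\<in>range p. h v *\<^sub>R E (p -` {v}))"
proof -
  have "(\<Sum>v\<in>range p. h v *\<^sub>R E (p -` {v}))
      = (\<Sum>c\<in>h ` range p. \<Sum>v\<in>{v \<in> range p. h v = c}. h v *\<^sub>R E (p -` {v}))"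
    by (rule sum.image_gen) (rule simple_function_borelD[OF p])
  also have "\<dots> = (\<Sum>c\<in>h ` range p. c *\<^sub>R (\<Sum>v\<in>{v \<in> range p. h v = c}. E (p -` {v})))"
    by (auto simp: scaleR_sum_right intro!: sum.cong)
  also have "\<dots> = (\<Sum>c\<in>h ` range p. c *\<^sub>R E ((\<lambda>u. h (p u)) -` {c}))"
  proof (intro sum.cong refl arg_cong2[where f = scaleR])
    fix c
    have "(\<Sum>v\<in>{v \<in> range p. h v = c}. E (p -` {v})) = E (\<Union>v\<in>{v \<in> range p. h v = c}. p -` {v})"
      using simple_function_borelD[OF p]
      by (intro pvm_UN_finite[symmetric]) (auto simp: disjoint_family_on_def)
    also have "(\<Union>v\<in>{v \<in> range p. h v = c}. p -` {v}) = (\<lambda>u. h (p u)) -` {c}"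
      by auto
    finally show "(\<Sum>v\<in>{v \<in> range p. h v = c}. E (p -` {v})) = E ((\<lambda>u. h (p u)) -` {c})" .
  qed
  also have "h ` range p = range (\<lambda>u. h (p u))"
    by auto
  finally show ?thesis
    unfolding simple_op_def by simp
qed

lemma simple_op_add:
  assumes "simple_function borel s" "simple_function borel t"
  shows "simple_op (\<lambda>u. s u + t u) = simple_op s + simple_op t"
proof -
  have p: "simple_function borel (\<lambda>u. (s u, t u))"
    using assms by (rule simple_function_Pair)
  show ?thesis
    using simple_op_partition[OF p, of "\<lambda>(a, b). a + b"]
      simple_op_partition[OF p, of fst] simple_op_partition[OF p, of snd]
    by (simp add: sum.distrib[symmetric] scaleR_add_left split_beta)
qed

lemma simple_op_scale:
  assumes "simple_function borel s"
  shows "simple_op (\<lambda>u. a * s u) = a *\<^sub>R simple_op s"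
  using simple_op_partition[OF assms, of "\<lambda>v. a * v"]
  by (simp add: simple_op_def[of s] scaleR_sum_right)

lemma simple_op_diff:
  assumes "simple_function borel s" "simple_function borel t"
  shows "simple_op (\<lambda>u. s u - t u) = simple_op s - simple_op t"
  using simple_op_add[OF assms(1), of "\<lambda>u. (- 1) * t u"] simple_op_scale[OF assms(2), of "- 1"] assms
  by (simp add: simple_function_compose1[OF assms(2)])

text \<open>
  Projections onto disjoint sets have orthogonal ranges, so this is the theorem of Pythagoras. It
  turns every norm estimate into an estimate of an integral against \<open>spectral_weight E x\<close>.
\<close>

lemma norm_simple_op_sq:
  assumes s: "simple_function borel s"
  shows "(norm (simple_op s x))\<^sup>2 = inner x (simple_op (\<lambda>u. (s u)\<^sup>2) x)"
proof -
  note s' = simple_function_borelD[OF s]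
  have orth: "inner (E (s -` {c}) x) (E (s -` {d}) x) = 0" if "c \<noteq> d" for c d
  proof -
    have "inner (E (s -` {c}) x) (E (s -` {d}) x) = inner x (E (s -` {c} \<inter> s -` {d}) x)"
      using s' by (simp add: pvm_symmetric pvm_Int)
    also have "s -` {c} \<inter> s -` {d} = {}"
      using that by auto
    finally show ?thesis by (simp add: pvm_empty)
  qed
  have "(norm (simple_op s x))\<^sup>2 = (norm (\<Sum>c\<in>range s. c *\<^sub>R E (s -` {c}) x))\<^sup>2"
    by (simp add: simple_op_def blinfun.sum_left blinfun.scaleR_left)
  also have "\<dots> = (\<Sum>c\<in>range s. (norm (c *\<^sub>R E (s -` {c}) x))\<^sup>2)"
    using s' by (intro norm_sum_Pythagorean) (auto simp: pairwise_def orthogonal_def orth)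
  also have "\<dots> = (\<Sum>c\<in>range s. c\<^sup>2 * inner x (E (s -` {c}) x))"
    using s' by (simp add: pvm_norm_sq power_mult_distrib)
  also have "\<dots> = inner x (simple_op (\<lambda>u. (s u)\<^sup>2) x)"
    by (subst simple_op_partition[OF s])
      (simp add: blinfun.sum_left blinfun.scaleR_left inner_sum_right)
  finally show ?thesis .
qed


lemma sets_spectral_weight [simp, measurable_cong]: "sets (spectral_weight E x) = sets borel"
  and space_spectral_weight [simp]: "space (spectral_weight E x) = UNIV"
  unfolding spectral_weight_def
  by (metis sets.sigma_sets_eq sets_measure_of space_borel sets.space_closed, simp add: space_measure_of_conv)

lemma emeasure_spectral_weight:
  assumes "A \<in> sets borel"
  shows "emeasure (spectral_weight E x) A = ennreal (inner x (E A x))"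
proof -
  let ?m = "\<lambda>A. ennreal (inner x (E A x))"
  have "emeasure (measure_of UNIV (sets borel) ?m) A = ?m A"
  proof (rule emeasure_measure_of_sigma)
    show "sigma_algebra UNIV (sets (borel :: real measure))"
      using sets.sigma_algebra_axioms[of "borel :: real measure"] by simp
    show "positive (sets borel) ?m"
      by (simp add: positive_def pvm_empty)
    show "countably_additive (sets borel) ?m"
    proof (rule countably_additiveI)
      fix B :: "nat \<Rightarrow> real set"
      assume B: "range B \<subseteq> sets borel" "disjoint_family B" "\<Union> (range B) \<in> sets borel"
      have "(\<lambda>n. inner x (E (B n) x)) sums inner x (E (\<Union>n. B n) x)"
        by (rule bounded_linear.sums[OF bounded_linear_inner_right pvm_sums[OF B(1,2)]])
      moreover have "inner x (E (B n) x) \<ge> 0" for n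
        using B(1) by (simp add: pvm_norm_sq image_subset_iff)
      ultimately show "(\<Sum>n. ?m (B n)) = ?m (\<Union>n. B n)"
        by (intro suminf_ennreal_eq)
    qed
  qed fact
  then show ?thesis
    by (simp add: spectral_weight_def Re_cinner)
qed

lemma finite_measure_spectral_weight: "finite_measure (spectral_weight E x)"
  by (rule finite_measureI) (simp add: emeasure_spectral_weight)

lemma measure_spectral_weight:
  "A \<in> sets borel \<Longrightarrow> measure (spectral_weight E x) A = inner x (E A x)"
  by (simp add: measure_def emeasure_spectral_weight pvm_norm_sq)

lemma has_bochner_integral_simple_op:
  assumes s: "simple_function borel s"
  shows "has_bochner_integral (spectral_weight E x) s (inner x (simple_op s x))"
proof -
  interpret finite_measure "spectral_weight E x"
    by (rule finite_measure_spectral_weight)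
  note s' = simple_function_borelD[OF s]
  have "has_bochner_integral (spectral_weight E x) (\<lambda>u. \<Sum>c\<in>range s. indicator (s -` {c}) u * c)
      (\<Sum>c\<in>range s. measure (spectral_weight E x) (s -` {c}) * c)"
    using s' by (intro has_bochner_integral_sum has_bochner_integral_mult_left
        has_bochner_integral_real_indicator) (auto simp: less_top[symmetric])
  also have "(\<lambda>u. \<Sum>c\<in>range s. indicator (s -` {c}) u * c) = s"
  proof
    fix u
    have "(\<Sum>c\<in>range s. indicator (s -` {c}) u * c) = (\<Sum>c\<in>range s. if c = s u then c else 0)"
      by (intro sum.cong) (auto simp: indicator_def)
    then show "(\<Sum>c\<in>range s. indicator (s -` {c}) u * c) = s u"
      using s' by simp
  qed
  also have "(\<Sum>c\<in>range s. measure (spectral_weight E x) (s -` {c}) * c) = inner x (simple_op s x)"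
    using s' by (simp add: measure_spectral_weight simple_op_def blinfun.sum_left
        blinfun.scaleR_left inner_sum_right mult.commute)
  finally show ?thesis .
qed

lemma nn_integral_simple_op:
  assumes s: "simple_function borel s"
  shows "(\<integral>\<^sup>+ u. ennreal ((s u)\<^sup>2) \<partial>spectral_weight E x) = ennreal ((norm (simple_op s x))\<^sup>2)"
proof -
  have "has_bochner_integral (spectral_weight E x) (\<lambda>u. (s u)\<^sup>2) ((norm (simple_op s x))\<^sup>2)"
    using has_bochner_integral_simple_op[OF simple_function_compose1[OF s, of "\<lambda>v. v\<^sup>2"], of x]
    by (simp add: norm_simple_op_sq[OF s])
  then show ?thesis
    by (simp add: has_bochner_integral_iff nn_integral_eq_integral)
qed

text \<open>
  Restricting to vectors in the range of \<open>E K\<close> is how the estimates below are localised: they only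
  see the values of a function on \<open>K\<close>. Both \<open>K = {l..}\<close> and bounded intervals below \<open>l\<close> will be used.
\<close>

lemma AE_spectral_weight:
  assumes K: "K \<in> sets borel" and x: "E K x = x"
  shows "AE u in spectral_weight E x. u \<in> K"
proof (rule AE_I)
  have "E (- K) x = E (- K \<inter> K) x"
    using pvm_Int[of "- K" K x] K x by (metis borel_comp)
  then show "emeasure (spectral_weight E x) (- K) = 0"
    using K by (simp add: emeasure_spectral_weight pvm_empty)
qed (use K in auto)

lemma inner_simple_op_le:
  assumes s: "simple_function borel s" and K: "K \<in> sets borel" and x: "E K x = x"
    and le: "\<And>u. u \<in> K \<Longrightarrow> s u \<le> C"
  shows "inner x (simple_op s x) \<le> C * (norm x)\<^sup>2"
proof -
  interpret finite_measure "spectral_weight E x"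
    by (rule finite_measure_spectral_weight)
  note int = has_bochner_integral_simple_op[OF s, of x]
  have "(\<integral>u. s u \<partial>spectral_weight E x) \<le> (\<integral>u. C \<partial>spectral_weight E x)"
    using int AE_spectral_weight[OF K x] le
    by (intro integral_mono_AE) (auto simp: has_bochner_integral_iff)
  also have "\<dots> = C * (norm x)\<^sup>2"
    by (simp add: measure_spectral_weight pvm_UNIV power2_norm_eq_inner)
  finally show ?thesis
    using int by (simp add: has_bochner_integral_iff)
qed

lemma norm_simple_op_le:
  assumes s: "simple_function borel s" and K: "K \<in> sets borel" and x: "E K x = x"
    and le: "\<And>u. u \<in> K \<Longrightarrow> \<bar>s u\<bar> \<le> C" and C: "C \<ge> 0"
  shows "norm (simple_op s x) \<le> C * norm x"
proof -
  have "(s u)\<^sup>2 \<le> C\<^sup>2" if "u \<in> K" for u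
    using power_mono[OF le[OF that], of 2] by simp
  then have "(norm (simple_op s x))\<^sup>2 \<le> (C * norm x)\<^sup>2"
    using inner_simple_op_le[OF simple_function_compose1[OF s, of "\<lambda>v. v\<^sup>2"] K x]
    by (simp add: norm_simple_op_sq[OF s] power_mult_distrib)
  then show ?thesis
    by (rule power2_le_imp_le) (use C in simp)
qed

lemma norm_simple_op_compose_le:
  assumes s: "simple_function borel s" and K: "K \<in> sets borel"
    and le: "\<And>u. u \<in> K \<Longrightarrow> \<bar>s u\<bar> \<le> C" and C: "C \<ge> 0"
  shows "norm (simple_op s o\<^sub>L E K) \<le> C"
proof (rule norm_blinfun_bound[OF C])
  fix x
  have "E K (E K x) = E K x"
    by (metis Int_absorb K pvm_Int)
  then have "norm (simple_op s (E K x)) \<le> C * norm (E K x)"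
    using norm_simple_op_le[OF s K _ le C] by blast
  also have "\<dots> \<le> C * norm x"
    using C K by (intro mult_left_mono pvm_norm_le)
  finally show "norm ((simple_op s o\<^sub>L E K) x) \<le> C * norm x"
    by simp
qed


text \<open>
  \<open>A\<close> is the integral of \<open>f\<close> over \<open>K\<close> against \<open>E\<close>, obtained as an operator-norm limit along
  simple functions converging to \<open>f\<close> uniformly on \<open>K\<close>. Off \<open>K\<close> nothing is asked of them; composing with
  \<open>E K\<close> makes \<open>f\<close> matter on \<open>K\<close> only.
\<close>

definition has_spectral_calc :: "real set \<Rightarrow> (real \<Rightarrow> real) \<Rightarrow> ('h, 'h) blinfun \<Rightarrow> bool"
  where "has_spectral_calc K f A \<longleftrightarrow> f \<in> borel_measurable borel \<and>
    (\<exists>s e. (\<forall>n. simple_function borel (s n)) \<and> (\<forall>n. \<forall>u\<in>K. \<bar>f u - s n u\<bar> \<le> e n) \<and>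
      e \<longlonglongrightarrow> (0::real) \<and> (\<forall>n. e n \<ge> 0) \<and> (\<lambda>n. simple_op (s n) o\<^sub>L E K) \<longlonglongrightarrow> A)"

lemma has_spectral_calcE:
  assumes "has_spectral_calc K f A"
  obtains s e where "f \<in> borel_measurable borel" "\<And>n. simple_function borel (s n)"
    "\<And>n u. u \<in> K \<Longrightarrow> \<bar>f u - s n u\<bar> \<le> e n" "e \<longlonglongrightarrow> (0::real)" "\<And>n. e n \<ge> 0"
    "(\<lambda>n::nat. simple_op (s n) o\<^sub>L E K) \<longlonglongrightarrow> A"
  using assms unfolding has_spectral_calc_def by blast

lemma has_spectral_calc_cong:
  assumes "has_spectral_calc K f A" "\<And>u. u \<in> K \<Longrightarrow> f u = g u" "g \<in> borel_measurable borel"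
  shows "has_spectral_calc K g A"
  using assms unfolding has_spectral_calc_def by simp

lemma has_spectral_calc_add:
  assumes "has_spectral_calc K f A" "has_spectral_calc K g B"
  shows "has_spectral_calc K (\<lambda>u. f u + g u) (A + B)"
proof -
  obtain s d where s: "f \<in> borel_measurable borel" "\<And>n. simple_function borel (s n)"
    "\<And>n u. u \<in> K \<Longrightarrow> \<bar>f u - s n u\<bar> \<le> d n" "d \<longlonglongrightarrow> (0::real)" "\<And>n. d n \<ge> 0"
    "(\<lambda>n::nat. simple_op (s n) o\<^sub>L E K) \<longlonglongrightarrow> A"
    using has_spectral_calcE[OF assms(1)] by blast
  obtain t e where t: "g \<in> borel_measurable borel" "\<And>n. simple_function borel (t n)"
    "\<And>n u. u \<in> K \<Longrightarrow> \<bar>g u - t n u\<bar> \<le> e n" "e \<longlonglongrightarrow> (0::real)" "\<And>n. e n \<ge> 0"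
    "(\<lambda>n::nat. simple_op (t n) o\<^sub>L E K) \<longlonglongrightarrow> B"
    using has_spectral_calcE[OF assms(2)] by blast
  show ?thesis
    unfolding has_spectral_calc_def
  proof (intro conjI exI[where x = "\<lambda>n u. s n u + t n u"] exI[where x = "\<lambda>n. d n + e n"] allI ballI)
    show "\<bar>f u + g u - (s n u + t n u)\<bar> \<le> d n + e n" if "u \<in> K" for n u
      using s(3)[OF that, of n] t(3)[OF that, of n] by linarith
    show "(\<lambda>n. d n + e n) \<longlonglongrightarrow> 0"
      using tendsto_add[OF s(4) t(4)] by simp
    show "(\<lambda>n. simple_op (\<lambda>u. s n u + t n u) o\<^sub>L E K) \<longlonglongrightarrow> A + B"
      using tendsto_add[OF s(6) t(6)]
      by (simp add: simple_op_add[OF s(2) t(2)] bounded_bilinear.add_left[OF bounded_bilinear_blinfun_compose])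
  qed (use s t in \<open>auto intro: simple_function_add\<close>)
qed

lemma has_spectral_calc_scaleR:
  assumes "has_spectral_calc K f A"
  shows "has_spectral_calc K (\<lambda>u. c * f u) (c *\<^sub>R A)"
proof -
  obtain s d where s: "f \<in> borel_measurable borel" "\<And>n. simple_function borel (s n)"
    "\<And>n u. u \<in> K \<Longrightarrow> \<bar>f u - s n u\<bar> \<le> d n" "d \<longlonglongrightarrow> (0::real)" "\<And>n. d n \<ge> 0"
    "(\<lambda>n::nat. simple_op (s n) o\<^sub>L E K) \<longlonglongrightarrow> A"
    using has_spectral_calcE[OF assms] by blast
  show ?thesis
    unfolding has_spectral_calc_def
  proof (intro conjI exI[where x = "\<lambda>n u. c * s n u"] exI[where x = "\<lambda>n. \<bar>c\<bar> * d n"] allI ballI)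
    show "\<bar>c * f u - c * s n u\<bar> \<le> \<bar>c\<bar> * d n" if "u \<in> K" for n u
      using s(3)[OF that, of n] by (metis abs_ge_zero abs_mult mult_left_mono right_diff_distrib)
    show "(\<lambda>n. \<bar>c\<bar> * d n) \<longlonglongrightarrow> 0"
      using tendsto_mult_left[OF s(4), of "\<bar>c\<bar>"] by simp
    show "(\<lambda>n. simple_op (\<lambda>u. c * s n u) o\<^sub>L E K) \<longlonglongrightarrow> c *\<^sub>R A"
      using tendsto_scaleR[OF tendsto_const s(6), of c]
      by (simp add: simple_op_scale[OF s(2)] bounded_bilinear.scaleR_left[OF bounded_bilinear_blinfun_compose])
  qed (use s in \<open>auto intro: simple_function_compose1[OF s(2)]\<close>)
qed

lemma has_spectral_calc_norm_le:
  assumes A: "has_spectral_calc K f A" and K: "K \<in> sets borel"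
    and le: "\<And>u. u \<in> K \<Longrightarrow> \<bar>f u\<bar> \<le> C" and C: "C \<ge> 0"
  shows "norm A \<le> C"
proof -
  obtain s d where s: "f \<in> borel_measurable borel" "\<And>n. simple_function borel (s n)"
    "\<And>n u. u \<in> K \<Longrightarrow> \<bar>f u - s n u\<bar> \<le> d n" "d \<longlonglongrightarrow> (0::real)" "\<And>n. d n \<ge> 0"
    "(\<lambda>n::nat. simple_op (s n) o\<^sub>L E K) \<longlonglongrightarrow> A"
    using has_spectral_calcE[OF A] by blast
  have "norm (simple_op (s n) o\<^sub>L E K) \<le> C + d n" for n
  proof (rule norm_simple_op_compose_le[OF s(2) K])
    show "\<bar>s n u\<bar> \<le> C + d n" if "u \<in> K" for u
      using s(3)[OF that, of n] le[OF that] by linarith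
  qed (use C s(5) in auto)
  moreover have "(\<lambda>n. C + d n) \<longlonglongrightarrow> C"
    using tendsto_add[OF tendsto_const s(4), of C] by simp
  ultimately show ?thesis
    using tendsto_norm[OF s(6)] by (blast intro: LIMSEQ_le)
qed

lemma has_spectral_calc_inner_le:
  assumes A: "has_spectral_calc K f A" and K: "K \<in> sets borel" and x: "E K x = x"
    and le: "\<And>u. u \<in> K \<Longrightarrow> f u \<le> C"
  shows "inner x (A x) \<le> C * (norm x)\<^sup>2"
proof -
  obtain s d where s: "f \<in> borel_measurable borel" "\<And>n. simple_function borel (s n)"
    "\<And>n u. u \<in> K \<Longrightarrow> \<bar>f u - s n u\<bar> \<le> d n" "d \<longlonglongrightarrow> (0::real)" "\<And>n. d n \<ge> 0"
    "(\<lambda>n::nat. simple_op (s n) o\<^sub>L E K) \<longlonglongrightarrow> A"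
    using has_spectral_calcE[OF A] by blast
  have "inner x ((simple_op (s n) o\<^sub>L E K) x) \<le> (C + d n) * (norm x)\<^sup>2" for n
  proof -
    have "s n u \<le> C + d n" if "u \<in> K" for u
      using s(3)[OF that, of n] le[OF that] by linarith
    from inner_simple_op_le[OF s(2) K x this] show ?thesis
      by (simp add: x)
  qed
  moreover have "(\<lambda>n. (C + d n) * (norm x)\<^sup>2) \<longlonglongrightarrow> (C + 0) * (norm x)\<^sup>2"
    by (intro tendsto_intros s)
  moreover have "(\<lambda>n. inner x ((simple_op (s n) o\<^sub>L E K) x)) \<longlonglongrightarrow> inner x (A x)"
    by (intro tendsto_intros s)
  ultimately show ?thesis
    by (metis (no_types, lifting) LIMSEQ_le add.right_neutral)
qed

lemma has_spectral_calc_exists: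
  assumes f: "f \<in> borel_measurable borel" and K: "K \<in> sets borel"
    and le: "\<And>u. u \<in> K \<Longrightarrow> \<bar>f u\<bar> \<le> C"
  shows "\<exists>A. has_spectral_calc K f A"
proof -
  define s where "s n u = (if u \<in> K then of_int \<lfloor>real (Suc n) * f u\<rfloor> / real (Suc n) else 0)" for n u
  define e where "e n = inverse (real (Suc n))" for n
  have lim: "e \<longlonglongrightarrow> 0"
    unfolding e_def by (rule LIMSEQ_inverse_real_of_nat)
  have e0: "e n \<ge> 0" for n
    by (simp add: e_def)
  have se: "\<bar>f u - s n u\<bar> \<le> e n" if "u \<in> K" for n u
  proof -
    have "\<bar>real (Suc n) * f u - of_int \<lfloor>real (Suc n) * f u\<rfloor>\<bar> \<le> 1"
      by linarith
    then have "\<bar>real (Suc n) * f u - of_int \<lfloor>real (Suc n) * f u\<rfloor>\<bar> / real (Suc n) \<le> 1 / real (Suc n)"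
      by (rule divide_right_mono) simp
    moreover have "f u - s n u = (real (Suc n) * f u - of_int \<lfloor>real (Suc n) * f u\<rfloor>) / real (Suc n)"
      using that by (simp add: s_def diff_divide_distrib del: of_nat_Suc)
    ultimately show ?thesis
      by (simp add: e_def inverse_eq_divide del: of_nat_Suc)
  qed
  have simple: "simple_function borel (s n)" for n
  proof (rule simple_function_borel_measurable)
    show "s n \<in> borel_measurable borel"
      unfolding s_def using f K by measurable
    have "range (s n) \<subseteq> insert 0 ((\<lambda>k. of_int k / real (Suc n)) ` {- \<lceil>real (Suc n) * C\<rceil> .. \<lceil>real (Suc n) * C\<rceil>})"
    proof
      fix v assume "v \<in> range (s n)"
      then obtain u where u: "v = s n u" by blast
      show "v \<in> insert 0 ((\<lambda>k. of_int k / real (Suc n)) ` {- \<lceil>real (Suc n) * C\<rceil> .. \<lceil>real (Suc n) * C\<rceil>})"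
      proof (cases "u \<in> K")
        case True
        have "\<bar>real (Suc n) * f u\<bar> \<le> real (Suc n) * C"
          unfolding abs_mult using le[OF True] by (simp add: mult_left_mono)
        then have "\<lfloor>real (Suc n) * f u\<rfloor> \<in> {- \<lceil>real (Suc n) * C\<rceil> .. \<lceil>real (Suc n) * C\<rceil>}"
          unfolding atLeastAtMost_iff abs_le_iff by linarith
        then show ?thesis
          using True unfolding u s_def by simp
      qed (simp add: u s_def)
    qed
    then show "finite (s n ` space borel)"
      by (auto intro: finite_subset)
  qed
  let ?S = "\<lambda>n. simple_op (s n) o\<^sub>L E K"
  have diff: "norm (?S m - ?S n) \<le> e m + e n" for m n
  proof -
    have "norm (simple_op (\<lambda>u. s m u - s n u) o\<^sub>L E K) \<le> e m + e n"
    proof (rule norm_simple_op_compose_le[OF simple_function_diff[OF simple simple] K])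
      show "\<bar>s m u - s n u\<bar> \<le> e m + e n" if "u \<in> K" for u
        using se[OF that, of m] se[OF that, of n] by linarith
    qed (use e0 in simp)
    then show ?thesis
      by (simp add: simple_op_diff[OF simple simple] bounded_bilinear.diff_left[OF bounded_bilinear_blinfun_compose])
  qed
  have "Cauchy ?S"
  proof (rule metric_CauchyI)
    fix r :: real assume "r > 0"
    then obtain N where N: "\<And>n. n \<ge> N \<Longrightarrow> e n < r / 2"
      using order_tendstoD(2)[OF lim, of "r / 2"] by (auto simp: eventually_sequentially)
    have "dist (?S m) (?S n) < r" if "m \<ge> N" "n \<ge> N" for m n
      using diff[of m n] N[OF that(1)] N[OF that(2)] by (simp add: dist_norm)
    then show "\<exists>N. \<forall>m\<ge>N. \<forall>n\<ge>N. dist (?S m) (?S n) < r" by blast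
  qed
  then obtain A where "?S \<longlonglongrightarrow> A"
    using Cauchy_convergent_iff convergent_def by blast
  with f simple se lim e0 show ?thesis
    unfolding has_spectral_calc_def by blast
qed

text \<open>
  The graph in \<^const>\<open>spectral_integral\<close> allows an approximating sequence that depends on \<open>x\<close> and
  converges only in mean square. Any two such sequences differ by a null sequence, because
  \<open>s \<mapsto> simple_op s x\<close> is isometric for the mean-square norm; so the uniform sequence gives the
  only possible value.
\<close>

lemma has_spectral_calc_graph:
  assumes A: "has_spectral_calc K f A" and K: "K \<in> sets borel" and x: "E K x = x"
  shows "(x, y) \<in> spectral_integral E f \<longleftrightarrow> y = A x"
proof -
  interpret finite_measure "spectral_weight E x"
    by (rule finite_measure_spectral_weight)
  obtain s d where f: "f \<in> borel_measurable borel" and s: "\<And>n. simple_function borel (s n)"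
    and d: "\<And>n u. u \<in> K \<Longrightarrow> \<bar>f u - s n u\<bar> \<le> d n" "d \<longlonglongrightarrow> (0::real)" "\<And>n. d n \<ge> 0"
    and SA: "(\<lambda>n::nat. simple_op (s n) o\<^sub>L E K) \<longlonglongrightarrow> A"
    using has_spectral_calcE[OF A] by blast
  have lim: "(\<lambda>n. simple_op (s n) x) \<longlonglongrightarrow> A x"
    using blinfun.tendsto[OF SA tendsto_const, of x] by (simp add: x)
  let ?I = "\<lambda>s n. \<integral>\<^sup>+ u. ennreal ((f u - s n u)\<^sup>2) \<partial>spectral_weight E x"
  have "?I s \<longlonglongrightarrow> 0"
  proof (rule tendsto_sandwich[OF _ _ tendsto_const])
    have "?I s n \<le> (\<integral>\<^sup>+ u. ennreal ((d n)\<^sup>2) \<partial>spectral_weight E x)" for n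
    proof (rule nn_integral_mono_AE)
      show "AE u in spectral_weight E x. ennreal ((f u - s n u)\<^sup>2) \<le> ennreal ((d n)\<^sup>2)"
        using AE_spectral_weight[OF K x]
      proof eventually_elim
        case (elim u)
        show ?case
          using power_mono[OF d(1)[OF elim, of n], of 2] by (simp add: ennreal_leI)
      qed
    qed
    also have "(\<integral>\<^sup>+ u. ennreal ((d n)\<^sup>2) \<partial>spectral_weight E x) = ennreal ((d n)\<^sup>2 * (norm x)\<^sup>2)" for n
      by (simp add: emeasure_spectral_weight pvm_UNIV power2_norm_eq_inner ennreal_mult')
    finally show "\<forall>\<^sub>F n in sequentially. ?I s n \<le> ennreal ((d n)\<^sup>2 * (norm x)\<^sup>2)"
      by simp
    have "(\<lambda>n. ennreal ((d n)\<^sup>2 * (norm x)\<^sup>2)) \<longlonglongrightarrow> ennreal (0\<^sup>2 * (norm x)\<^sup>2)"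
      by (intro tendsto_intros d)
    then show "(\<lambda>n. ennreal ((d n)\<^sup>2 * (norm x)\<^sup>2)) \<longlonglongrightarrow> 0"
      by simp
  qed simp
  note Is = this
  show ?thesis
  proof
    assume "y = A x"
    with f s Is lim show "(x, y) \<in> spectral_integral E f"
      unfolding spectral_integral_def simple_spectral_integral_eq by blast
  next
    assume "(x, y) \<in> spectral_integral E f"
    then obtain t where t: "\<And>n. simple_function borel (t n)" and It: "?I t \<longlonglongrightarrow> 0"
      and y: "(\<lambda>n. simple_op (t n) x) \<longlonglongrightarrow> y"
      unfolding spectral_integral_def simple_spectral_integral_eq by blast
    have [measurable]: "s n \<in> borel_measurable borel" "t n \<in> borel_measurable borel" for n
      using s t by (auto intro: borel_measurable_simple_function)
    note [measurable] = f
    let ?D = "\<lambda>n. ennreal ((norm (simple_op (s n) x - simple_op (t n) x))\<^sup>2)"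
    have "?D n \<le> 2 * ?I s n + 2 * ?I t n" for n
    proof -
      have "?D n = (\<integral>\<^sup>+ u. ennreal ((s n u - t n u)\<^sup>2) \<partial>spectral_weight E x)"
        using nn_integral_simple_op[OF simple_function_diff[OF s[of n] t[of n]], where x = x]
        by (simp add: simple_op_diff[OF s t] blinfun.diff_left)
      also have "\<dots> \<le> (\<integral>\<^sup>+ u. 2 * ennreal ((f u - s n u)\<^sup>2) + 2 * ennreal ((f u - t n u)\<^sup>2) \<partial>spectral_weight E x)"
      proof (rule nn_integral_mono)
        fix u
        have "(s n u - t n u)\<^sup>2 \<le> 2 * (f u - s n u)\<^sup>2 + 2 * (f u - t n u)\<^sup>2"
          using zero_le_power2[of "(f u - s n u) + (f u - t n u)"]
          by (simp add: power2_eq_square algebra_simps)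
        then have "ennreal ((s n u - t n u)\<^sup>2) \<le> ennreal (2 * (f u - s n u)\<^sup>2 + 2 * (f u - t n u)\<^sup>2)"
          by (rule ennreal_leI)
        then show "ennreal ((s n u - t n u)\<^sup>2) \<le> 2 * ennreal ((f u - s n u)\<^sup>2) + 2 * ennreal ((f u - t n u)\<^sup>2)"
          by (simp add: ennreal_plus ennreal_mult')
      qed
      also have "\<dots> = 2 * ?I s n + 2 * ?I t n"
        by (simp add: nn_integral_add nn_integral_cmult)
      finally show ?thesis .
    qed
    moreover have "(\<lambda>n. 2 * ?I s n + 2 * ?I t n) \<longlonglongrightarrow> 2 * 0 + 2 * 0"
      by (intro tendsto_add ennreal_tendsto_cmult Is It) simp_all
    ultimately have "?D \<longlonglongrightarrow> 0"
      by (intro tendsto_sandwich[OF _ _ tendsto_const, of _ ?D]) auto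
    moreover have "?D \<longlonglongrightarrow> ennreal ((norm (A x - y))\<^sup>2)"
      by (intro tendsto_intros lim y)
    ultimately have "ennreal ((norm (A x - y))\<^sup>2) = 0"
      using LIMSEQ_unique by blast
    then show "y = A x"
      by simp
  qed
qed

text \<open>
  For \<open>b < l\<close>, a vector \<open>x\<close> in the range of \<open>E {a..<b}\<close> lies in the domain of \<open>L\<close> and satisfies
  \<open>l * (norm x)\<^sup>2 \<le> inner x (L x) \<le> b * (norm x)\<^sup>2\<close>, so it vanishes. Intervals bounded away from \<open>l\<close> are
  taken because on \<open>{a..<l}\<close> the two bounds would coincide; countably many of them exhaust \<open>{..<l}\<close>.
\<close>

lemma pvm_lower_bound:
  assumes L: "spectral_integral E (\<lambda>u. u) = L" and l: "bounded_below_by L l"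
  shows "E {l..} = id_blinfun"
proof (rule blinfun_eqI)
  fix z
  have zero: "E {a..<b} z = 0" if "b < l" for a b
  proof -
    let ?K = "{a..<b}" let ?x = "E ?K z"
    have x: "E ?K ?x = ?x"
      by (metis Int_absorb pvm_Int atLeastLessThan_borel)
    obtain A where A: "has_spectral_calc ?K (\<lambda>u. u) A"
      using has_spectral_calc_exists[of "\<lambda>u. u" ?K "max \<bar>a\<bar> \<bar>b\<bar>"] by fastforce
    have "(?x, A ?x) \<in> L"
      using has_spectral_calc_graph[OF A _ x] L by simp
    then have "l * (norm ?x)\<^sup>2 \<le> inner ?x (A ?x)"
      using l unfolding bounded_below_by_def by (auto simp: Re_cinner)
    also have "\<dots> \<le> b * (norm ?x)\<^sup>2"
      by (rule has_spectral_calc_inner_le[OF A _ x]) auto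
    finally have "(l - b) * (norm ?x)\<^sup>2 \<le> 0"
      by (simp add: algebra_simps)
    with that show ?thesis
      by (simp add: mult_le_0_iff)
  qed
  have "{..<l} = (\<Union>n. {- real n..<l - inverse (real (Suc n))})"
  proof (intro equalityI subsetI)
    fix u assume "u \<in> {..<l}"
    then obtain m where "inverse (real (Suc m)) < l - u"
      using reals_Archimedean[of "l - u"] by auto
    moreover obtain k where "- u \<le> real k"
      using real_arch_simple by blast
    moreover define n where "n = max m k"
    moreover have "inverse (real (Suc n)) \<le> inverse (real (Suc m))" "real k \<le> real n"
      unfolding n_def by (auto intro!: le_imp_inverse_le)
    ultimately have "inverse (real (Suc n)) < l - u" "- u \<le> real n"
      by linarith+
    then show "u \<in> (\<Union>n. {- real n..<l - inverse (real (Suc n))})"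
      by (intro UN_I[of n]) auto
  qed (auto intro: less_le_trans)
  moreover have "emeasure (spectral_weight E z) (\<Union>n. {- real n..<l - inverse (real (Suc n))}) = 0"
    by (rule emeasure_UN_eq_0) (auto simp: emeasure_spectral_weight zero simp del: of_nat_Suc)
  ultimately have "emeasure (spectral_weight E z) {..<l} = 0"
    by simp
  then have "E {..<l} z = 0"
    by (simp add: emeasure_spectral_weight pvm_norm_sq)
  moreover have "E UNIV = E {..<l} + E {l..}"
  proof -
    have "{..<l} \<union> {l..} = UNIV" "{..<l} \<inter> {l..} = {}" by auto
    then show ?thesis
      using pvm_Un[of "{..<l}" "{l..}"] by simp
  qed
  ultimately show "E {l..} z = id_blinfun z"
    by (metis add_0 blinfun.add_left pvm_UNIV)
qed

end

lemma to_blinfun_graph: "to_blinfun {(x, y). y = blinfun_apply A x} = A"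
  unfolding to_blinfun_def
  by (rule the_equality) (auto simp: set_eq_iff intro!: blinfun_eqI)

lemma spectral_integral_zero:
  assumes "f \<in> borel_measurable borel"
  shows "spectral_integral (\<lambda>_. 0 :: ('h::complex_hilbert, 'h) blinfun) f = {(x, y). y = 0}"
proof -
  have simple: "simple_spectral_integral (\<lambda>_. 0 :: ('h, 'h) blinfun) s x = 0" for s x
    by (simp add: simple_spectral_integral_def)
  have "Re (cinner x (0::'h)) = 0" for x
    by (simp add: Re_cinner)
  then have "emeasure (spectral_weight (\<lambda>_. 0 :: ('h, 'h) blinfun) x) A = 0" for x A
    unfolding spectral_weight_def emeasure_measure_of_conv by simp
  then have "AE u in spectral_weight (\<lambda>_. 0 :: ('h, 'h) blinfun) x. g u = 0" for x and g :: "real \<Rightarrow> ennreal"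
    by (rule emeasure_0_AE)
  then have "(\<integral>\<^sup>+ u. g u \<partial>spectral_weight (\<lambda>_. 0 :: ('h, 'h) blinfun) x) = 0" for x g
    by (subst nn_integral_cong_AE[of g "\<lambda>_. 0"]) auto
  then show ?thesis
    using assms unfolding spectral_integral_def simple
    by (auto intro!: exI[where x = "\<lambda>_ _. 0"] dest: LIMSEQ_const_iff[THEN iffD1])
qed

text \<open>
  The hypothesis on \<open>f\<close> and \<open>g\<close> restricts to \<open>{l..}\<close>, since the spectral measure does not charge the
  complement. Without a spectral measure, \<^const>\<open>spectral_measure\<close> is constantly \<open>0\<close>, all
  functions of \<open>L\<close> are \<open>0\<close>, and \<open>\<Phi> = 0\<close>.
\<close>

lemma bounded_functional_calculus:
  fixes L :: "'h::complex_hilbert graph_op"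
  assumes l: "bounded_below_by L l"
  obtains \<Phi> :: "(real \<Rightarrow>\<^sub>C real) \<Rightarrow> ('h, 'h) blinfun" where "bounded_linear \<Phi>"
    "\<And>f g. f \<in> borel_measurable borel \<Longrightarrow> (\<And>u. u \<ge> l \<Longrightarrow> f u = apply_bcontfun g u) \<Longrightarrow>
      op_fun f L = {(x, y). y = blinfun_apply (\<Phi> g) x}"
proof (cases "\<exists>E. is_spectral_measure E L")
  case False
  then have "spectral_measure L = (\<lambda>_. 0)"
    by (simp add: spectral_measure_def)
  then show ?thesis
    by (intro that[of "\<lambda>_. 0"]) (auto simp: op_fun_def spectral_integral_zero)
next
  case True
  define E where "E = spectral_measure L"
  have "is_spectral_measure E L"
    using someI_ex[OF True] True by (simp add: E_def spectral_measure_def)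
  then have E: "projection_valued_measure E" and L: "spectral_integral E (\<lambda>u. u) = L"
    by (auto simp: is_spectral_measure_def)
  let ?calc = "has_spectral_calc E {l..}"
  have id: "blinfun_apply (E {l..}) x = x" for x
    by (simp add: pvm_lower_bound[OF E L l])
  have graph: "spectral_integral E f = {(x, y). y = blinfun_apply A x}" if "?calc f A" for f A
    using has_spectral_calc_graph[OF E that _ id] by auto
  then have unique: "A = B" if "?calc f A" "?calc f B" for f A B
    using that by (metis to_blinfun_graph)
  have meas: "apply_bcontfun g \<in> borel_measurable borel" for g :: "real \<Rightarrow>\<^sub>C real"
    by (intro borel_measurable_continuous_onI) auto
  have "\<exists>A. ?calc (apply_bcontfun g) A" for g
    using has_spectral_calc_exists[OF E meas, of "{l..}" g "norm g"] norm_bounded[of g] by auto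
  then obtain \<Phi> where \<Phi>: "\<And>g. ?calc (apply_bcontfun g) (\<Phi> g)"
    by metis
  show ?thesis
  proof
    show "bounded_linear \<Phi>"
    proof (rule bounded_linear_intro[where K = 1])
      fix g h :: "real \<Rightarrow>\<^sub>C real" and c
      show "\<Phi> (g + h) = \<Phi> g + \<Phi> h"
        using has_spectral_calc_add[OF E \<Phi> \<Phi>, of g h] \<Phi>[of "g + h"]
        by (auto intro: unique simp: plus_bcontfun.rep_eq)
      show "\<Phi> (c *\<^sub>R g) = c *\<^sub>R \<Phi> g"
        using has_spectral_calc_scaleR[OF E \<Phi>, of c g] \<Phi>[of "c *\<^sub>R g"]
        by (auto intro: unique simp: scaleR_bcontfun.rep_eq)
      show "norm (\<Phi> g) \<le> norm g * 1"
        using has_spectral_calc_norm_le[OF E \<Phi>, of g "norm g"] norm_bounded[of g] by auto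
    qed
    fix f :: "real \<Rightarrow> real" and g assume f: "f \<in> borel_measurable borel" "\<And>u. u \<ge> l \<Longrightarrow> f u = apply_bcontfun g u"
    have "?calc f (\<Phi> g)"
      using has_spectral_calc_cong[OF E \<Phi>] f by (metis atLeast_iff)
    then show "op_fun f L = {(x, y). y = blinfun_apply (\<Phi> g) x}"
      unfolding op_fun_def E_def[symmetric] by (rule graph)
  qed
qed


section \<open>Powers and exponentials as curves of bounded continuous functions\<close>

text \<open>
  Evaluation at a point is a bounded linear functional, so it commutes with the integral, and the
  evaluations separate the functions.
\<close>

lemma has_norm_bochner_integral_bcontfunI:
  fixes F :: "'a \<Rightarrow> 'c::metric_space \<Rightarrow>\<^sub>C 'b::{real_normed_vector, second_countable_topology}"
  assumes F: "norm_bochner_integrable M F"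
    and J: "\<And>u. has_bochner_integral M (\<lambda>q. apply_bcontfun (F q) u) (apply_bcontfun J u)"
  shows "has_norm_bochner_integral M F J"
proof -
  obtain I where I: "has_norm_bochner_integral M F I"
    using F unfolding norm_bochner_integrable_def by blast
  have "apply_bcontfun I u = apply_bcontfun J u" for u
  proof -
    have "bounded_linear (\<lambda>h :: 'c \<Rightarrow>\<^sub>C 'b. apply_bcontfun h u)"
      by (rule bounded_linear_intro[where K = 1])
        (auto simp: plus_bcontfun.rep_eq scaleR_bcontfun.rep_eq norm_bounded)
    from has_norm_bochner_integral_bounded_linear[OF this I]
    have "has_bochner_integral M (\<lambda>q. apply_bcontfun (F q) u) (apply_bcontfun I u)"
      by (rule has_norm_bochner_integral_imp_has_bochner_integral)
    then show ?thesis
      using J has_bochner_integral_eq by blast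
  qed
  then show ?thesis
    using I bcontfun_eqI by metis
qed

text \<open>
  The restriction of \<open>f\<close> to \<open>{l..}\<close>, extended by the constant \<open>f l\<close> to the left. The operators see \<open>f\<close> on
  \<open>{l..}\<close> only, and there the powers and exponentials in question are bounded and continuous.
\<close>

definition const_extend :: "real \<Rightarrow> (real \<Rightarrow> real) \<Rightarrow> (real \<Rightarrow>\<^sub>C real)"
  where "const_extend l f = Bcontfun (\<lambda>u. f (max l u))"

lemma apply_const_extend:
  assumes "continuous_on {l..} f" "\<And>u. u \<ge> l \<Longrightarrow> \<bar>f u\<bar> \<le> C"
  shows "apply_bcontfun (const_extend l f) u = f (max l u)"
proof -
  have "(\<lambda>u. f (max l u)) \<in> bcontfun"
  proof (rule bcontfun_normI)
    show "continuous_on UNIV (\<lambda>u. f (max l u))"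
      by (rule continuous_on_compose2[OF assms(1)]) (auto intro!: continuous_intros)
    show "norm (f (max l u)) \<le> C" for u
      using assms(2)[of "max l u"] by simp
  qed
  then show ?thesis
    unfolding const_extend_def by (simp add: Bcontfun_inverse)
qed

lemma apply_const_extend_powr:
  assumes "l > 0" "a \<ge> 0" "s \<ge> 0"
  shows "apply_bcontfun (const_extend l (\<lambda>u. (u + a) powr (- s))) u = (max l u + a) powr (- s)"
proof (rule apply_const_extend)
  show "continuous_on {l..} (\<lambda>u. (u + a) powr (- s))"
    using assms by (intro continuous_intros) auto
  show "\<bar>(u + a) powr (- s)\<bar> \<le> (l + a) powr (- s)" if "u \<ge> l" for u
    using assms that by (simp add: powr_mono2')
qed

lemma apply_const_extend_exp:
  assumes "t > 0"
  shows "apply_bcontfun (const_extend l (\<lambda>u. exp (- t * u))) u = exp (- t * max l u)"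
proof (rule apply_const_extend)
  show "continuous_on {l..} (\<lambda>u. exp (- t * u))"
    by (intro continuous_intros)
  show "\<bar>exp (- t * u)\<bar> \<le> exp (- t * l)" if "u \<ge> l" for u
    using assms that by simp
qed

lemma norm_const_extend_powr_le:
  assumes "l > 0" "a \<ge> 0" "s \<ge> 0"
  shows "norm (const_extend l (\<lambda>u. (u + a) powr (- s))) \<le> (l + a) powr (- s)"
  by (rule norm_bound) (use assms in \<open>simp add: apply_const_extend_powr powr_mono2'\<close>)

lemma norm_const_extend_exp_le:
  assumes "t > 0"
  shows "norm (const_extend l (\<lambda>u. exp (- t * u))) \<le> exp (- t * l)"
  by (rule norm_bound) (use assms in \<open>simp only: apply_const_extend_exp, simp\<close>)

lemma continuous_on_const_extend_powr:
  assumes l: "l > 0" and s: "s \<ge> 0"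
  shows "continuous_on {0..} (\<lambda>a. const_extend l (\<lambda>u. (u + a) powr (- s)))"
proof (rule lipschitz_on_continuous_on, rule lipschitz_onI)
  let ?B = "s * l powr (- s - 1)"
  show "?B \<ge> 0" using s by simp
  fix a b :: real assume ab: "a \<in> {0..}" "b \<in> {0..}"
  show "dist (const_extend l (\<lambda>u. (u + a) powr (- s))) (const_extend l (\<lambda>u. (u + b) powr (- s))) \<le> ?B * dist a b"
  proof (rule dist_bound)
    fix u
    have "norm ((max l u + a) powr (- s) - (max l u + b) powr (- s))
        \<le> ?B * norm ((max l u + a) - (max l u + b))"
    proof (rule field_differentiable_bound)
      show "convex {l..}" by simp
      show "((\<lambda>x. x powr (- s)) has_field_derivative - s * x powr (- s - 1)) (at x within {l..})" if "x \<in> {l..}" for x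
        using that l by (auto intro!: derivative_eq_intros)
      show "norm (- s * x powr (- s - 1)) \<le> ?B" if "x \<in> {l..}" for x
        using that l s by (auto simp: abs_mult intro!: mult_left_mono powr_mono2')
    qed (use ab in auto)
    then show "dist (apply_bcontfun (const_extend l (\<lambda>u. (u + a) powr (- s))) u)
        (apply_bcontfun (const_extend l (\<lambda>u. (u + b) powr (- s))) u) \<le> ?B * dist a b"
      using ab l s by (simp add: apply_const_extend_powr dist_real_def)
  qed
qed

text \<open>
  The derivative of \<open>exp (-t * v)\<close> in \<open>t\<close> is bounded uniformly in \<open>v > 0\<close> once \<open>t\<close> stays above some
  \<open>c > 0\<close>, because \<open>v * exp (-c * v) \<le> 1 / c\<close>. There is no such bound down to \<open>t = 0\<close>.
\<close>

lemma continuous_on_const_extend_exp: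
  assumes l: "l > 0"
  shows "continuous_on {0<..} (\<lambda>t. const_extend l (\<lambda>u. exp (- t * u)))"
proof (rule continuous_at_imp_continuous_on, rule ballI)
  fix r :: real assume "r \<in> {0<..}"
  define c where "c = r / 2"
  have c: "c > 0" "c < r" using \<open>r \<in> {0<..}\<close> by (auto simp: c_def)
  have "continuous_on {c..} (\<lambda>t. const_extend l (\<lambda>u. exp (- t * u)))"
  proof (rule lipschitz_on_continuous_on, rule lipschitz_onI)
    show "1 / c \<ge> 0" using c by simp
    fix a b :: real assume ab: "a \<in> {c..}" "b \<in> {c..}"
    show "dist (const_extend l (\<lambda>u. exp (- a * u))) (const_extend l (\<lambda>u. exp (- b * u))) \<le> 1 / c * dist a b"
    proof (rule dist_bound)
      fix u
      let ?v = "max l u"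
      have v: "?v > 0" using l by simp
      have "norm (exp (- a * ?v) - exp (- b * ?v)) \<le> 1 / c * norm (a - b)"
      proof (rule field_differentiable_bound)
        show "convex {c..}" by simp
        show "((\<lambda>x. exp (- x * ?v)) has_field_derivative - ?v * exp (- x * ?v)) (at x within {c..})" for x
          by (auto intro!: derivative_eq_intros)
        show "norm (- ?v * exp (- x * ?v)) \<le> 1 / c" if "x \<in> {c..}" for x
        proof -
          have "c * ?v \<le> exp (c * ?v)"
            using exp_ge_add_one_self[of "c * ?v"] by linarith
          then have "?v * exp (- (c * ?v)) \<le> 1 / c"
            using c by (simp add: exp_minus field_simps)
          moreover have "?v * exp (- x * ?v) \<le> ?v * exp (- (c * ?v))"
            using v that by (intro mult_left_mono) (auto intro: mult_right_mono)
          ultimately have "?v * exp (- x * ?v) \<le> 1 / c"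
            by (rule order_trans[rotated])
          then show ?thesis
            using v by (simp add: abs_mult)
        qed
      qed (use ab in auto)
      then show "dist (apply_bcontfun (const_extend l (\<lambda>u. exp (- a * u))) u)
          (apply_bcontfun (const_extend l (\<lambda>u. exp (- b * u))) u) \<le> 1 / c * dist a b"
        using ab c by (simp only: apply_const_extend_exp atLeast_iff less_le_trans dist_norm)
    qed
  qed
  then show "isCont (\<lambda>t. const_extend l (\<lambda>u. exp (- t * u))) r"
    by (rule continuous_on_interior) (use c in simp)
qed

lemma has_norm_bochner_integral_const_extend_powr:
  fixes l s :: real
  assumes l: "l > 0" and s: "s > DIM('a) / 2"
  shows "has_norm_bochner_integral lborel
    (\<lambda>q::'a::euclidean_space. const_extend l (\<lambda>u. (u + (norm q)\<^sup>2) powr (- s)))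
    ((pi powr (DIM('a) / 2) * (Gamma (s - DIM('a) / 2) / Gamma s)) *\<^sub>R const_extend l (\<lambda>u. u powr (DIM('a) / 2 - s)))"
proof -
  let ?d = "real DIM('a) / 2"
  let ?k = "pi powr ?d * (Gamma (s - ?d) / Gamma s)"
  have s0: "s > 0" using s by (smt (verit) divide_nonneg_nonneg of_nat_0_le_iff)
  have k: "?k \<ge> 0"
    using s0 s by (intro mult_nonneg_nonneg divide_nonneg_nonneg less_imp_le[OF Gamma_real_pos]) auto
  have int: "has_bochner_integral lborel (\<lambda>q::'a. (v + (norm q)\<^sup>2) powr (- s)) (?k * v powr (?d - s))" if "v > 0" for v
    by (intro has_bochner_integral_nn_integral nn_integral_shifted_norm_powr that s
        mult_nonneg_nonneg[OF k powr_ge_zero]) auto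
  show ?thesis
  proof (rule has_norm_bochner_integral_bcontfunI)
    show "norm_bochner_integrable lborel (\<lambda>q::'a. const_extend l (\<lambda>u. (u + (norm q)\<^sup>2) powr (- s)))"
    proof (rule norm_bochner_integrable_dominated_continuous[where U = UNIV and g = "\<lambda>q. (l + (norm q)\<^sup>2) powr (- s)"])
      show "continuous_on UNIV (\<lambda>q::'a. const_extend l (\<lambda>u. (u + (norm q)\<^sup>2) powr (- s)))"
        using s0 by (intro continuous_on_compose2[OF continuous_on_const_extend_powr[OF l]]) (auto intro!: continuous_intros)
      show "integrable lborel (\<lambda>q::'a. (l + (norm q)\<^sup>2) powr (- s))"
        using int[OF l] by (simp add: has_bochner_integral_iff)
    qed (use l s0 in \<open>auto intro: norm_const_extend_powr_le\<close>)
    fix u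
    have "apply_bcontfun (const_extend l (\<lambda>u. u powr (?d - s))) u = max l u powr (?d - s)"
      using apply_const_extend_powr[of l 0 "s - ?d" u] l s by simp
    then show "has_bochner_integral lborel
        (\<lambda>q::'a. apply_bcontfun (const_extend l (\<lambda>u. (u + (norm q)\<^sup>2) powr (- s))) u)
        (apply_bcontfun (?k *\<^sub>R const_extend l (\<lambda>u. u powr (?d - s))) u)"
      using int[of "max l u"] l s0 by (simp add: apply_const_extend_powr scaleR_bcontfun.rep_eq)
  qed
qed

lemma has_norm_bochner_integral_const_extend_exp:
  fixes l b :: real
  assumes l: "l > 0" and b: "b > 0"
  shows "has_norm_bochner_integral lborel
    (\<lambda>t. (indicator {0<..} t * t powr (b - 1)) *\<^sub>R const_extend l (\<lambda>u. exp (- t * u)))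
    (Gamma b *\<^sub>R const_extend l (\<lambda>u. u powr (- b)))"
proof -
  have G: "Gamma b > 0" by (rule Gamma_real_pos) fact
  have int: "has_bochner_integral lborel (\<lambda>t. indicator {0<..} t * t powr (b - 1) * exp (- t * v)) (Gamma b * v powr (- b))"
    if "v > 0" for v
    using G by (intro has_bochner_integral_nn_integral nn_integral_powr_exp that b) auto
  show ?thesis
  proof (rule has_norm_bochner_integral_bcontfunI)
    show "norm_bochner_integrable lborel (\<lambda>t. (indicator {0<..} t * t powr (b - 1)) *\<^sub>R const_extend l (\<lambda>u. exp (- t * u)))"
    proof (rule norm_bochner_integrable_dominated_continuous[where U = "{0<..} :: real set"
          and F = "\<lambda>t. (indicator {0<..} t * t powr (b - 1)) *\<^sub>R const_extend l (\<lambda>u. exp (- t * u))"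
          and g = "\<lambda>t. indicator {0<..} t * t powr (b - 1) * exp (- t * l)"])
      have "continuous_on {0<..} (\<lambda>t. t powr (b - 1) *\<^sub>R const_extend l (\<lambda>u. exp (- t * u)))"
        by (intro continuous_intros continuous_on_const_extend_exp l) auto
      then show "continuous_on {0<..} (\<lambda>t. (indicator {0<..} t * t powr (b - 1)) *\<^sub>R const_extend l (\<lambda>u. exp (- t * u)))"
        by (rule continuous_on_cong[THEN iffD1, rotated -1]) auto
      show "integrable lborel (\<lambda>t. indicator {0<..} t * t powr (b - 1) * exp (- t * l))"
        using int[OF l] by (simp add: has_bochner_integral_iff)
      show "norm ((indicator {0<..} t * t powr (b - 1)) *\<^sub>R const_extend l (\<lambda>u. exp (- t * u)))
          \<le> indicator {0<..} t * t powr (b - 1) * exp (- t * l)" if "t \<in> {0<..}" for t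
        using norm_const_extend_exp_le[of t l] that by (simp add: mult_left_mono)
    qed auto
    fix u
    have "apply_bcontfun (Gamma b *\<^sub>R const_extend l (\<lambda>u. u powr (- b))) u = Gamma b * max l u powr (- b)"
      using apply_const_extend_powr[of l 0 b u] l b by (simp add: scaleR_bcontfun.rep_eq)
    moreover have "apply_bcontfun ((indicator {0<..} t * t powr (b - 1)) *\<^sub>R const_extend l (\<lambda>u. exp (- t * u))) u
        = indicator {0<..} t * t powr (b - 1) * exp (- t * max l u)" for t
      by (cases "t > 0") (auto simp only: apply_const_extend_exp scaleR_bcontfun.rep_eq real_scaleR_def,
          auto simp: indicator_def)
    ultimately show "has_bochner_integral lborel
        (\<lambda>t. apply_bcontfun ((indicator {0<..} t * t powr (b - 1)) *\<^sub>R const_extend l (\<lambda>u. exp (- t * u))) u)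
        (apply_bcontfun (Gamma b *\<^sub>R const_extend l (\<lambda>u. u powr (- b))) u)"
      using int[of "max l u"] l by (simp only: less_max_iff_disj simp_thms)
  qed
qed


section \<open>The transverse integral\<close>

theorem proposition4p2:
  fixes L :: "'h::complex_hilbert graph_op" and l s :: real
  assumes "self_adjoint L"
    and "l > 0"
    and "bounded_below_by L l"
    and "s > real CARD('m::finite) / 2"
  shows
    "(\<forall>q :: real ^ 'm. everywhere_bounded (op_shift_powr ((norm q)\<^sup>2) (- s) L)) \<and>
     norm_bochner_integrable lborel (T_integrand s L :: real ^ 'm \<Rightarrow> ('h, 'h) blinfun) \<and>

     (\<forall>t > 0. everywhere_bounded (op_exp (- t) L)) \<and>
     norm_bochner_integrable lborel (heat_integrand (s - 1 - real CARD('m) / 2) L) \<and>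
     T_op TYPE('m) s L =
       (1 / ((4 * pi) powr (real CARD('m) / 2) * Gamma s)) *\<^sub>R
         norm_bochner_integral lborel (heat_integrand (s - 1 - real CARD('m) / 2) L) \<and>

     everywhere_bounded (op_powr (real CARD('m) / 2 - s) L) \<and>
     T_op TYPE('m) s L =
       (1 / (4 * pi) powr (real CARD('m) / 2) * (Gamma (s - real CARD('m) / 2) / Gamma s)) *\<^sub>R
         to_blinfun (op_powr (real CARD('m) / 2 - s) L)"
proof -
  let ?d = "real CARD('m) / 2"
  let ?b = "s - ?d"
  have l: "l > 0" and b: "?b > 0" and s: "s > 0"
    using assms(2,4) by (auto intro: le_less_trans[rotated])
  obtain \<Phi> :: "(real \<Rightarrow>\<^sub>C real) \<Rightarrow> ('h, 'h) blinfun" where \<Phi>: "bounded_linear \<Phi>"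
    and calc: "\<And>f g. f \<in> borel_measurable borel \<Longrightarrow> (\<And>u. u \<ge> l \<Longrightarrow> f u = apply_bcontfun g u) \<Longrightarrow>
      op_fun f L = {(x, y). y = blinfun_apply (\<Phi> g) x}"
    using bounded_functional_calculus[OF assms(3)] by metis
  interpret \<Phi>: bounded_linear \<Phi> by fact

  have shift: "op_shift_powr a (- r) L = {(x, y). y = blinfun_apply (\<Phi> (const_extend l (\<lambda>u. (u + a) powr (- r)))) x}"
    if "a \<ge> 0" "r \<ge> 0" for a r
    unfolding op_shift_powr_def using l that by (intro calc) (auto simp: apply_const_extend_powr max_absorb2)
  have heat: "op_exp (- t) L = {(x, y). y = blinfun_apply (\<Phi> (const_extend l (\<lambda>u. exp (- t * u)))) x}"
    if "t > 0" for t
    unfolding op_exp_def by (intro calc) (use that in \<open>simp_all only: apply_const_extend_exp max_absorb2, simp\<close>)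
  define P where "P = \<Phi> (const_extend l (\<lambda>u. u powr (?d - s)))"
  have P: "op_powr (?d - s) L = {(x, y). y = blinfun_apply P x}"
    using shift[of 0 ?b] b by (simp add: P_def)

  have T: "has_norm_bochner_integral lborel (T_integrand s L :: real ^ 'm \<Rightarrow> _)
      ((1 / (4 * pi) powr ?d * (Gamma ?b / Gamma s)) *\<^sub>R P)"
  proof -
    have "T_integrand s L = (\<lambda>q :: real ^ 'm. (1 / (2 * pi) ^ CARD('m)) *\<^sub>R \<Phi> (const_extend l (\<lambda>u. (u + (norm q)\<^sup>2) powr (- s))))"
      using s by (auto simp: T_integrand_def fun_eq_iff shift to_blinfun_graph)
    \<comment> \<open>\<open>(2 * pi) ^ m = (4 * pi\<^sup>2) powr (m/2)\<close>\<close>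
    moreover have "(1 / (2 * pi) ^ CARD('m)) * (pi powr ?d * (Gamma ?b / Gamma s)) = 1 / (4 * pi) powr ?d * (Gamma ?b / Gamma s)"
    proof -
      have "(2 * pi) ^ CARD('m) = (2 * pi) powr (?d + ?d)"
        by (simp add: powr_realpow)
      also have "\<dots> = ((2 * pi) * (2 * pi)) powr ?d"
        by (simp only: powr_add, subst powr_mult[symmetric]) auto
      also have "\<dots> = (4 * pi) powr ?d * pi powr ?d"
        by (subst powr_mult[symmetric]) (auto simp: mult_ac)
      finally show ?thesis by simp
    qed
    ultimately show ?thesis
      using has_norm_bochner_integral_bounded_linear[OF
          bounded_linear_compose[OF bounded_linear_scaleR_right[of "1 / (2 * pi) ^ CARD('m)"] \<Phi>]
          has_norm_bochner_integral_const_extend_powr[where 'a = "real ^ 'm", of l s]] l assms(4)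
      by (simp add: \<Phi>.scaleR P_def)
  qed
  have H: "has_norm_bochner_integral lborel (heat_integrand (s - 1 - ?d) L) (Gamma ?b *\<^sub>R P)"
  proof -
    have "heat_integrand (s - 1 - ?d) L
        = (\<lambda>t. \<Phi> ((indicator {0<..} t * t powr (?b - 1)) *\<^sub>R const_extend l (\<lambda>u. exp (- t * u))))"
    proof
      fix t
      have "s - 1 - ?d = ?b - 1" by simp
      then show "heat_integrand (s - 1 - ?d) L t = \<Phi> ((indicator {0<..} t * t powr (?b - 1)) *\<^sub>R const_extend l (\<lambda>u. exp (- t * u)))"
        by (cases "t > 0") (simp_all only: heat_integrand_def, simp_all add: heat to_blinfun_graph \<Phi>.scaleR \<Phi>.zero)
    qed
    then show ?thesis
      using has_norm_bochner_integral_bounded_linear[OF \<Phi> has_norm_bochner_integral_const_extend_exp[OF l b]]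
      by (simp add: \<Phi>.scaleR P_def)
  qed
  have "everywhere_bounded (op_shift_powr ((norm q)\<^sup>2) (- s) L)" for q :: "real ^ 'm"
    using shift[of "(norm q)\<^sup>2" s] s unfolding everywhere_bounded_def by auto
  moreover have "everywhere_bounded (op_exp (- t) L)" if "t > 0" for t
    using heat[OF that] unfolding everywhere_bounded_def by blast
  moreover have "everywhere_bounded (op_powr (?d - s) L)"
    using P unfolding everywhere_bounded_def by blast
  moreover have "T_op TYPE('m) s L = (1 / (4 * pi) powr ?d * (Gamma ?b / Gamma s)) *\<^sub>R P"
    unfolding T_op_def by (rule norm_bochner_integral_eq[OF T])
  moreover have "norm_bochner_integral lborel (heat_integrand (s - 1 - ?d) L) = Gamma ?b *\<^sub>R P"
    by (rule norm_bochner_integral_eq[OF H])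
  moreover have "to_blinfun (op_powr (?d - s) L) = P"
    unfolding P by (rule to_blinfun_graph)
  ultimately show ?thesis
    using T H unfolding norm_bochner_integrable_def by auto
qed

end
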